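(* Let $n\ge 2$ and let $\mathfrak{G}$ be a generalized $n$-matrix ring, with components $\mathfrak{G}_{ij}$ and center $\mathfrak{Z}(\mathfrak{G})$. Let $B:\mathfrak{G}\times\mathfrak{G}\to\mathfrak{G}$ be a biadditive map such that: (i) for all $p,q,r,s\in\{1,\dots,n\}$: $B(\mathfrak{G}_{pp},\mathfrak{G}_{qq})\subseteq \mathfrak{G}_{pp}\cap\mathfrak{G}_{qq}$; if $r\neq s$, then $B(\mathfrak{G}_{pp},\mathfrak{G}_{rs})\subseteq\mathfrak{G}_{rs}$ and $B(\mathfrak{G}_{rs},\mathfrak{G}_{pp})\subseteq\mathfrak{G}_{rs}$; if $p\neq q$ and $r\neq s$, then $B(\mathfrak{G}_{pq},\mathfrak{G}_{rs})=0$; (ii) for every element $c=\sum_{1\le p\neq q\le n}c_{pq}$ with $c_{pq}\in\mathfrak{G}_{pq}$: if $B(c,\mathfrak{G}_{nn})=0$ or $B\big(\bigoplus_{1\le r<n}\mathfrak{G}_{rr},c\big)=0$, then $c=0$; (iii) for every $a_{nn}\in\mathfrak{G}_{nn}$: $B(\mathfrak{G}_{nn},a_{nn})=0$ implies $a_{nn}=0$; (iv) for all $c_{pp}\in\mathfrak{G}_{pp}$ ($1\le p\le n$): if $B\big(\sum_{p=1}^n c_{pp},\mathfrak{G}_{rs}\big)=B\big(\mathfrak{G}_{rs},\sum_{p=1}^n c_{pp}\big)=0$ for all $1\le r\neq s\le n$, then $\sum_{p=1}^{n-1}c_{pp}+(-c_{nn})\in\mathfrak{Z}(\mathfrak{G})$;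 (v) for every $c=\sum_{p=1}^n c_{pp}\in\mathfrak{Z}(\mathfrak{G})$ (with $c_{pp}\in\mathfrak{G}_{pp}$): $B(c_{pp},d_{pp})=B(d_{pp},c_{pp})$ for all $1\le p\le n$ and $d_{pp}\in\mathfrak{G}_{pp}$; and $B(c_{pp},d_{pp})\,d_{pn}\,d_{nn}=d_{pp}\,d_{pn}\,B(c_{nn},d_{nn})$ for all $1\le p<n$, $d_{pp}\in\mathfrak{G}_{pp}$, $d_{pn}\in\mathfrak{G}_{pn}$, $d_{nn}\in\mathfrak{G}_{nn}$; (vi) $B\big(c_{rr},B(c_{kl},c_{nn})\big)=B\big(B(c_{rr},c_{kl}),c_{nn}\big)$ for all $1\le r\le n$, all $1\le k\neq l\le n$, and all $c_{rr}\in\mathfrak{G}_{rr}$, $c_{kl}\in\mathfrak{G}_{kl}$, $c_{nn}\in\mathfrak{G}_{nn}$. Let $f:\mathfrak{G}\times\mathfrak{G}\to\mathfrak{G}$ be a map (not assumed additive) satisfying: (vii) $f(x,0)=f(0,x)=0$ for all $x\in\mathfrak{G}$; (viii) $B\big(f(x,y),z\big)=f\big(B(x,z),B(y,z)\big)$ for all $x,y,z\in\mathfrak{G}$; (ix) $B\big(z,f(x,y)\big)=f\big(B(z,x),B(z,y)\big)$ for all $x,y,z\in\mathfrak{G}$. Then $f=0$.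
   Context: Rings are associative, not necessarily with identity. Generalized $n$-matrix ring: let $\mathfrak{R}_1,\dots,\mathfrak{R}_n$ be rings and, for $i,j\in\{1,\dots,n\}$, let $\mathfrak{M}_{ij}$ be an $(\mathfrak{R}_i,\mathfrak{R}_j)$-bimodule, with $\mathfrak{M}_{ii}=\mathfrak{R}_i$. Let $\varphi_{ijk}:\mathfrak{M}_{ij}\otimes_{\mathfrak{R}_j}\mathfrak{M}_{jk}\to\mathfrak{M}_{ik}$ be $(\mathfrak{R}_i,\mathfrak{R}_k)$-bimodule homomorphisms, where $\varphi_{iij}:\mathfrak{R}_i\otimes_{\mathfrak{R}_i}\mathfrak{M}_{ij}\to\mathfrak{M}_{ij}$ and $\varphi_{ijj}:\mathfrak{M}_{ij}\otimes_{\mathfrak{R}_j}\mathfrak{R}_j\to\mathfrak{M}_{ij}$ are the canonical isomorphisms (given by the module actions). Write $a\circ b=\varphi_{ijk}(a\otimes b)$ for $a\in\mathfrak{M}_{ij}$, $b\in\mathfrak{M}_{jk}$. It is assumed that for all $i\neq j$: (1) $\mathfrak{M}_{ij}$ is faithful as a left $\mathfrak{R}_i$-module and faithful as a right $\mathfrak{R}_j$-module; (2) if $m_{ij}\in\mathfrak{M}_{ij}$ satisfies $\mathfrak{R}_i m_{ij}\mathfrak{R}_j=0$, then $m_{ij}=0$. Let $\mathfrak{G}$ be the set of all $n\times n$ matrices $[m_{ij}]$ with $(i,j)$-entry $m_{ij}\in\mathfrak{M}_{ij}$, with the obvious matrix addition and multiplication (using $\circ$). When $a\circ(b\circ c)=(a\circ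 b)\circ c$ for all $a\in\mathfrak{M}_{ik}$, $b\in\mathfrak{M}_{kl}$, $c\in\mathfrak{M}_{lj}$ and all indices, $\mathfrak{G}$ is a ring, called a generalized $n$-matrix ring. $\mathfrak{G}_{ij}\subseteq\mathfrak{G}$ denotes the set of matrices whose entries are all zero except possibly the $(i,j)$-entry, so $\mathfrak{G}=\bigoplus_{i,j}\mathfrak{G}_{ij}$ as additive groups. $\mathfrak{Z}(\mathfrak{G})$ is the center of $\mathfrak{G}$; its elements are diagonal matrices. For subsets $X,Y$, $B(X,Y)$ denotes $\{B(x,y):x\in X,y\in Y\}$. Juxtaposition denotes the product in $\mathfrak{G}$. *)

theory Defs
  imports "HOL-Algebra.Free_Abelian_Groups" "HOL-Algebra.Module"
begin

section \<open>Rings without identity and bimodules\<close>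

text \<open>
  The locale \<open>ring\<close> of HOL-Algebra requires an identity.  Here the record type \<open>ring\<close> is
  reused, but its field \<open>one\<close> is never referred to.
\<close>

locale nonunital_ring = abelian_group R for R (structure) +
  assumes mult_closed:
      "\<lbrakk>x \<in> carrier R; y \<in> carrier R\<rbrakk> \<Longrightarrow> x \<otimes> y \<in> carrier R"
    and mult_assoc:
      "\<lbrakk>x \<in> carrier R; y \<in> carrier R; z \<in> carrier R\<rbrakk>
        \<Longrightarrow> (x \<otimes> y) \<otimes> z = x \<otimes> (y \<otimes> z)"
    and mult_l_distr:
      "\<lbrakk>x \<in> carrier R; y \<in> carrier R; z \<in> carrier R\<rbrakk>
        \<Longrightarrow> (x \<oplus> y) \<otimes> z = x \<otimes> z \<oplus> y \<otimes> z"
    and mult_r_distr: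
      "\<lbrakk>x \<in> carrier R; y \<in> carrier R; z \<in> carrier R\<rbrakk>
        \<Longrightarrow> z \<otimes> (x \<oplus> y) = z \<otimes> x \<oplus> z \<otimes> y"

definition ring_center :: "('a, 'b) ring_scheme \<Rightarrow> 'a set" where
  "ring_center R = {z \<in> carrier R. \<forall>x \<in> carrier R. z \<otimes>\<^bsub>R\<^esub> x = x \<otimes>\<^bsub>R\<^esub> z}"

text \<open>
  As in the library's record \<open>module\<close>, the multiplicative fields \<open>mult\<close> and \<open>one\<close> of a bimodule
  carry no meaning in general.
\<close>

record ('r, 's, 'm) bimodule = "'m ring" +
  lsmul :: "'r \<Rightarrow> 'm \<Rightarrow> 'm"
  rsmul :: "'m \<Rightarrow> 's \<Rightarrow> 'm"

locale nonunital_bimodule =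
  R: nonunital_ring R + S: nonunital_ring S + M: abelian_group M
  for R :: "('r, 'c) ring_scheme" and S :: "('s, 'd) ring_scheme"
    and M :: "('r, 's, 'm, 'e) bimodule_scheme" +
  assumes lsmul_closed:
      "\<lbrakk>r \<in> carrier R; x \<in> carrier M\<rbrakk> \<Longrightarrow> lsmul M r x \<in> carrier M"
    and rsmul_closed:
      "\<lbrakk>x \<in> carrier M; s \<in> carrier S\<rbrakk> \<Longrightarrow> rsmul M x s \<in> carrier M"
    and lsmul_l_distr:
      "\<lbrakk>r \<in> carrier R; r' \<in> carrier R; x \<in> carrier M\<rbrakk>
        \<Longrightarrow> lsmul M (r \<oplus>\<^bsub>R\<^esub> r') x = lsmul M r x \<oplus>\<^bsub>M\<^esub> lsmul M r' x"
    and lsmul_r_distr: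
      "\<lbrakk>r \<in> carrier R; x \<in> carrier M; y \<in> carrier M\<rbrakk>
        \<Longrightarrow> lsmul M r (x \<oplus>\<^bsub>M\<^esub> y) = lsmul M r x \<oplus>\<^bsub>M\<^esub> lsmul M r y"
    and rsmul_l_distr:
      "\<lbrakk>x \<in> carrier M; y \<in> carrier M; s \<in> carrier S\<rbrakk>
        \<Longrightarrow> rsmul M (x \<oplus>\<^bsub>M\<^esub> y) s = rsmul M x s \<oplus>\<^bsub>M\<^esub> rsmul M y s"
    and rsmul_r_distr:
      "\<lbrakk>x \<in> carrier M; s \<in> carrier S; s' \<in> carrier S\<rbrakk>
        \<Longrightarrow> rsmul M x (s \<oplus>\<^bsub>S\<^esub> s') = rsmul M x s \<oplus>\<^bsub>M\<^esub> rsmul M x s'"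
    and lsmul_assoc:
      "\<lbrakk>r \<in> carrier R; r' \<in> carrier R; x \<in> carrier M\<rbrakk>
        \<Longrightarrow> lsmul M (r \<otimes>\<^bsub>R\<^esub> r') x = lsmul M r (lsmul M r' x)"
    and rsmul_assoc:
      "\<lbrakk>x \<in> carrier M; s \<in> carrier S; s' \<in> carrier S\<rbrakk>
        \<Longrightarrow> rsmul M x (s \<otimes>\<^bsub>S\<^esub> s') = rsmul M (rsmul M x s) s'"
    and lsmul_rsmul:
      "\<lbrakk>r \<in> carrier R; x \<in> carrier M; s \<in> carrier S\<rbrakk>
        \<Longrightarrow> rsmul M (lsmul M r x) s = lsmul M r (rsmul M x s)"

definition faithful_left ::
    "('r, 'c) ring_scheme \<Rightarrow> ('r, 's, 'm, 'e) bimodule_scheme \<Rightarrow> bool" where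
  "faithful_left R M \<longleftrightarrow>
    (\<forall>r \<in> carrier R. (\<forall>x \<in> carrier M. lsmul M r x = \<zero>\<^bsub>M\<^esub>) \<longrightarrow> r = \<zero>\<^bsub>R\<^esub>)"

definition faithful_right ::
    "('s, 'd) ring_scheme \<Rightarrow> ('r, 's, 'm, 'e) bimodule_scheme \<Rightarrow> bool" where
  "faithful_right S M \<longleftrightarrow>
    (\<forall>s \<in> carrier S. (\<forall>x \<in> carrier M. rsmul M x s = \<zero>\<^bsub>M\<^esub>) \<longrightarrow> s = \<zero>\<^bsub>S\<^esub>)"

definition bimodule_hom ::
    "('r, 'c) ring_scheme \<Rightarrow> ('s, 'd) ring_scheme \<Rightarrow> ('r, 's, 'm, 'e) bimodule_scheme
      \<Rightarrow> ('r, 's, 'n, 'f) bimodule_scheme \<Rightarrow> ('m \<Rightarrow> 'n) set" where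
  "bimodule_hom R S M N =
    {h \<in> carrier M \<rightarrow> carrier N.
      (\<forall>x \<in> carrier M. \<forall>y \<in> carrier M. h (x \<oplus>\<^bsub>M\<^esub> y) = h x \<oplus>\<^bsub>N\<^esub> h y) \<and>
      (\<forall>r \<in> carrier R. \<forall>x \<in> carrier M. h (lsmul M r x) = lsmul N r (h x)) \<and>
      (\<forall>x \<in> carrier M. \<forall>s \<in> carrier S. h (rsmul M x s) = rsmul N (h x) s)}"

definition bimodule_iso ::
    "('r, 'c) ring_scheme \<Rightarrow> ('s, 'd) ring_scheme \<Rightarrow> ('r, 's, 'm, 'e) bimodule_scheme
      \<Rightarrow> ('r, 's, 'n, 'f) bimodule_scheme \<Rightarrow> ('m \<Rightarrow> 'n) set" where
  "bimodule_iso R S M N = {h \<in> bimodule_hom R S M N. bij_betw h (carrier M) (carrier N)}"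


section \<open>Tensor products of bimodules\<close>

text \<open>
  The tensor product over \<open>S\<close> of an \<open>(R, S)\<close>-bimodule and an \<open>(S, T)\<close>-bimodule is the quotient of
  the free abelian group on pairs by the subgroup generated by the biadditivity and balancing
  relations; its elements are cosets of that subgroup.
\<close>

definition tensor_free ::
    "('r, 's, 'm, 'e) bimodule_scheme \<Rightarrow> ('s, 't, 'n, 'f) bimodule_scheme
      \<Rightarrow> ('m \<times> 'n \<Rightarrow>\<^sub>0 int) monoid" where
  "tensor_free M N = free_Abelian_group (carrier M \<times> carrier N)"

definition tensor_relations ::
    "('s, 'c) ring_scheme \<Rightarrow> ('r, 's, 'm, 'e) bimodule_scheme
      \<Rightarrow> ('s, 't, 'n, 'f) bimodule_scheme \<Rightarrow> ('m \<times> 'n \<Rightarrow>\<^sub>0 int) set" where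
  "tensor_relations S M N =
    {frag_of (x \<oplus>\<^bsub>M\<^esub> x', y) - frag_of (x, y) - frag_of (x', y) | x x' y.
      x \<in> carrier M \<and> x' \<in> carrier M \<and> y \<in> carrier N} \<union>
    {frag_of (x, y \<oplus>\<^bsub>N\<^esub> y') - frag_of (x, y) - frag_of (x, y') | x y y'.
      x \<in> carrier M \<and> y \<in> carrier N \<and> y' \<in> carrier N} \<union>
    {frag_of (rsmul M x s, y) - frag_of (x, lsmul N s y) | x s y.
      x \<in> carrier M \<and> s \<in> carrier S \<and> y \<in> carrier N}"

definition tensor_subgroup ::
    "('s, 'c) ring_scheme \<Rightarrow> ('r, 's, 'm, 'e) bimodule_scheme
      \<Rightarrow> ('s, 't, 'n, 'f) bimodule_scheme \<Rightarrow> ('m \<times> 'n \<Rightarrow>\<^sub>0 int) set" where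
  "tensor_subgroup S M N = generate (tensor_free M N) (tensor_relations S M N)"

definition elem_tensor ::
    "('s, 'c) ring_scheme \<Rightarrow> ('r, 's, 'm, 'e) bimodule_scheme
      \<Rightarrow> ('s, 't, 'n, 'f) bimodule_scheme \<Rightarrow> 'm \<Rightarrow> 'n \<Rightarrow> ('m \<times> 'n \<Rightarrow>\<^sub>0 int) set" where
  "elem_tensor S M N x y = tensor_subgroup S M N #>\<^bsub>tensor_free M N\<^esub> frag_of (x, y)"

text \<open>
  The actions below are the ones induced by \<open>r (x \<otimes> y) = (r x) \<otimes> y\<close> and
  \<open>(x \<otimes> y) t = x \<otimes> (y t)\<close>: all representatives of a coset are sent into one and the same
  coset, so that the union over the representatives is that coset
  (see \<open>lsmul_elem_tensor\<close> and \<open>rsmul_elem_tensor\<close>).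
\<close>

definition tensor_bimodule ::
    "('s, 'c) ring_scheme \<Rightarrow> ('r, 's, 'm, 'e) bimodule_scheme
      \<Rightarrow> ('s, 't, 'n, 'f) bimodule_scheme \<Rightarrow> ('r, 't, ('m \<times> 'n \<Rightarrow>\<^sub>0 int) set) bimodule" where
  "tensor_bimodule S M N =
    (let F = tensor_free M N; H = tensor_subgroup S M N in
     \<lparr>carrier = carrier (F Mod H), mult = undefined, one = undefined,
      zero = \<one>\<^bsub>F Mod H\<^esub>, add = mult (F Mod H),
      lsmul = (\<lambda>r X. \<Union>u\<in>X. H #>\<^bsub>F\<^esub> frag_extend (\<lambda>(x, y). frag_of (lsmul M r x, y)) u),
      rsmul = (\<lambda>X t. \<Union>u\<in>X. H #>\<^bsub>F\<^esub> frag_extend (\<lambda>(x, y). frag_of (x, rsmul N y t)) u)\<rparr>)"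

lemma tensor_relations_carrier:
  assumes "nonunital_bimodule R S M" "nonunital_bimodule S T N"
  shows "tensor_relations S M N \<subseteq> carrier (tensor_free M N)"
proof -
  interpret M: nonunital_bimodule R S M by fact
  interpret N: nonunital_bimodule S T N by fact
  have *: "frag_of p \<in> carrier (tensor_free M N)" if "p \<in> carrier M \<times> carrier N" for p
    using that by (simp add: tensor_free_def)
  have d: "u - v \<in> carrier (tensor_free M N)"
    if "u \<in> carrier (tensor_free M N)" "v \<in> carrier (tensor_free M N)" for u v
    using that keys_diff[of u v] by (auto simp: tensor_free_def)
  show ?thesis
    unfolding tensor_relations_def
    by (intro Un_least subsetI; clarify; intro d *)
      (auto simp: M.rsmul_closed N.lsmul_closed)
qed

lemma subgroup_tensor_subgroup:
  assumes "nonunital_bimodule R S M" "nonunital_bimodule S T N"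
  shows "subgroup (tensor_subgroup S M N) (tensor_free M N)"
  unfolding tensor_subgroup_def
  by (intro group.generate_is_subgroup tensor_relations_carrier[OF assms])
    (simp add: tensor_free_def)

lemma frag_extend_tensor_subgroup:
  assumes bim: "nonunital_bimodule R S M" "nonunital_bimodule S T N"
    and g: "\<And>u. u \<in> tensor_relations S M N \<Longrightarrow> frag_extend g u \<in> tensor_subgroup S M N"
    and u: "u \<in> tensor_subgroup S M N"
  shows "frag_extend g u \<in> tensor_subgroup S M N"
proof -
  note H = subgroup_tensor_subgroup[OF bim]
  have neg: "- v \<in> tensor_subgroup S M N" if "v \<in> tensor_subgroup S M N" for v
  proof -
    have "v \<in> carrier (tensor_free M N)" using that subgroup.subset[OF H] by blast
    then show ?thesis
      using subgroup.m_inv_closed[OF H that] by (simp add: tensor_free_def)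
  qed
  have add: "v + w \<in> tensor_subgroup S M N"
    if "v \<in> tensor_subgroup S M N" "w \<in> tensor_subgroup S M N" for v w
    using subgroup.m_closed[OF H that] by (simp add: tensor_free_def)
  from u have "u \<in> generate (tensor_free M N) (tensor_relations S M N)"
    by (simp add: tensor_subgroup_def)
  then show ?thesis
  proof (induction u rule: generate.induct)
    case one
    then show ?case using subgroup.one_closed[OF H] by (simp add: tensor_free_def)
  next
    case (incl h)
    then show ?case by (rule g)
  next
    case (inv h)
    then have "h \<in> carrier (tensor_free M N)" using tensor_relations_carrier[OF bim] by blast
    then have "inv\<^bsub>tensor_free M N\<^esub> h = - h" by (simp add: tensor_free_def)
    then show ?case using neg[OF g[OF inv]] by (simp add: frag_extend_minus)
  next
    case (eng h1 h2)
    then show ?case using add by (simp add: tensor_free_def frag_extend_add)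
  qed
qed

lemma UN_frag_extend_elem_tensor:
  assumes bim: "nonunital_bimodule R S M" "nonunital_bimodule S T N"
    and g: "\<And>u. u \<in> tensor_relations S M N \<Longrightarrow>
      frag_extend (frag_of \<circ> g) u \<in> tensor_subgroup S M N"
    and mem: "g (x, y) \<in> carrier M \<times> carrier N"
  shows "(\<Union>u \<in> elem_tensor S M N x y.
      tensor_subgroup S M N #>\<^bsub>tensor_free M N\<^esub> frag_extend (frag_of \<circ> g) u)
    = tensor_subgroup S M N #>\<^bsub>tensor_free M N\<^esub> frag_of (g (x, y))"
    (is "(\<Union>u \<in> _. ?H #>\<^bsub>?F\<^esub> ?h u) = _")
proof -
  note H = subgroup_tensor_subgroup[OF bim]
  have gr: "group ?F" by (simp add: tensor_free_def)
  have "?H #>\<^bsub>?F\<^esub> ?h u = ?H #>\<^bsub>?F\<^esub> frag_of (g (x, y))" if u: "u \<in> elem_tensor S M N x y" for u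
  proof -
    obtain k where k: "k \<in> ?H" "u = k + frag_of (x, y)"
      using u by (auto simp: elem_tensor_def r_coset_def tensor_free_def)
    have hk: "?h k \<in> ?H" by (rule frag_extend_tensor_subgroup[OF bim g k(1)])
    have "?h u = ?h k \<otimes>\<^bsub>?F\<^esub> frag_of (g (x, y))"
      by (simp add: k frag_extend_add tensor_free_def)
    moreover have "frag_of (g (x, y)) \<in> carrier ?F"
      using mem by (simp add: tensor_free_def)
    moreover have "?h k \<in> carrier ?F"
      using subgroup.subset[OF H] hk by blast
    ultimately show ?thesis
      using group.coset_mult_assoc[OF gr subgroup.subset[OF H], of "?h k" "frag_of (g (x, y))"]
        group.coset_join2[OF gr _ H hk] by simp
  qed
  moreover have "elem_tensor S M N x y \<noteq> {}"
    using subgroup.one_closed[OF H] by (auto simp: elem_tensor_def r_coset_def)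
  ultimately show ?thesis by auto
qed

lemma lsmul_elem_tensor:
  assumes bim: "nonunital_bimodule R S M" "nonunital_bimodule S T N"
    and r: "r \<in> carrier R" and x: "x \<in> carrier M" and y: "y \<in> carrier N"
  shows "lsmul (tensor_bimodule S M N) r (elem_tensor S M N x y)
    = elem_tensor S M N (lsmul M r x) y"
proof -
  interpret M: nonunital_bimodule R S M by fact
  interpret N: nonunital_bimodule S T N by fact
  let ?g = "\<lambda>(x, y). (lsmul M r x, y)"
  have "frag_extend (frag_of \<circ> ?g) u \<in> tensor_relations S M N"
    if "u \<in> tensor_relations S M N" for u
    using that unfolding tensor_relations_def
    apply (elim UnE)
      apply (rule UnI1, rule UnI1, clarsimp simp: frag_extend_diff M.lsmul_r_distr r)
      apply (metis M.lsmul_closed r)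
     apply (rule UnI1, rule UnI2, clarsimp simp: frag_extend_diff)
     apply (metis M.lsmul_closed r)
    apply (rule UnI2, clarsimp simp: frag_extend_diff M.lsmul_rsmul[symmetric] r)
    apply (metis M.lsmul_closed r)
    done
  then have "frag_extend (frag_of \<circ> ?g) u \<in> tensor_subgroup S M N"
    if "u \<in> tensor_relations S M N" for u
    using that by (simp add: tensor_subgroup_def generate.incl)
  from UN_frag_extend_elem_tensor[OF bim this, of x y]
  show ?thesis
    using M.lsmul_closed[OF r x] y
    by (simp add: tensor_bimodule_def Let_def elem_tensor_def comp_def case_prod_unfold)
qed

lemma rsmul_elem_tensor:
  assumes bim: "nonunital_bimodule R S M" "nonunital_bimodule S T N"
    and x: "x \<in> carrier M" and y: "y \<in> carrier N" and t: "t \<in> carrier T"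
  shows "rsmul (tensor_bimodule S M N) (elem_tensor S M N x y) t
    = elem_tensor S M N x (rsmul N y t)"
proof -
  interpret M: nonunital_bimodule R S M by fact
  interpret N: nonunital_bimodule S T N by fact
  let ?g = "\<lambda>(x, y). (x, rsmul N y t)"
  have "frag_extend (frag_of \<circ> ?g) u \<in> tensor_relations S M N"
    if "u \<in> tensor_relations S M N" for u
    using that unfolding tensor_relations_def
    apply (elim UnE)
      apply (rule UnI1, rule UnI1, clarsimp simp: frag_extend_diff)
      apply (metis N.rsmul_closed t)
     apply (rule UnI1, rule UnI2, clarsimp simp: frag_extend_diff N.rsmul_l_distr t)
     apply (metis N.rsmul_closed t)
    apply (rule UnI2, clarsimp simp: frag_extend_diff N.lsmul_rsmul t)
    apply (metis N.rsmul_closed t)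
    done
  then have "frag_extend (frag_of \<circ> ?g) u \<in> tensor_subgroup S M N"
    if "u \<in> tensor_relations S M N" for u
    using that by (simp add: tensor_subgroup_def generate.incl)
  from UN_frag_extend_elem_tensor[OF bim this, of x y]
  show ?thesis
    using N.rsmul_closed[OF y t] x
    by (simp add: tensor_bimodule_def Let_def elem_tensor_def comp_def case_prod_unfold)
qed


section \<open>Generalized matrix rings\<close>

text \<open>
  The data are the bimodules \<open>M i j\<close> and the maps \<open>\<phi> i j k\<close> for \<open>i, j, k\<close> in \<open>{1..n}\<close>.  All
  \<open>M i j\<close> are given on carriers inside one type, which is no restriction since a family of
  sets can be embedded into a common type.  The \<open>i\<close>-th ring is the ring reduct of \<open>M i i\<close>, so
  the field \<open>mult\<close> is meaningful for the diagonal bimodules.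
\<close>

type_synonym 'a bimod_family = "nat \<Rightarrow> nat \<Rightarrow> ('a, 'a, 'a) bimodule"
type_synonym 'a tensor_maps = "nat \<Rightarrow> nat \<Rightarrow> nat \<Rightarrow> ('a \<times> 'a \<Rightarrow>\<^sub>0 int) set \<Rightarrow> 'a"
type_synonym 'a gmat = "nat \<times> nat \<Rightarrow> 'a"

definition gcomp ::
    "'a bimod_family \<Rightarrow> 'a tensor_maps \<Rightarrow> nat \<Rightarrow> nat \<Rightarrow> nat \<Rightarrow> 'a \<Rightarrow> 'a \<Rightarrow> 'a" where
  "gcomp M \<phi> i j k a b = \<phi> i j k (elem_tensor (M j j) (M i j) (M j k) a b)"

locale generalized_matrix_ring =
  fixes n :: nat and M :: "'a bimod_family" and \<phi> :: "'a tensor_maps"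
  assumes bimodules:
      "\<lbrakk>i \<in> {1..n}; j \<in> {1..n}\<rbrakk> \<Longrightarrow> nonunital_bimodule (M i i) (M j j) (M i j)"
    and diagonal_actions:
      "\<lbrakk>i \<in> {1..n}; a \<in> carrier (M i i); b \<in> carrier (M i i)\<rbrakk>
        \<Longrightarrow> lsmul (M i i) a b = a \<otimes>\<^bsub>M i i\<^esub> b \<and> rsmul (M i i) a b = a \<otimes>\<^bsub>M i i\<^esub> b"
    and phi_hom:
      "\<lbrakk>i \<in> {1..n}; j \<in> {1..n}; k \<in> {1..n}\<rbrakk>
        \<Longrightarrow> \<phi> i j k \<in> bimodule_hom (M i i) (M k k)
              (tensor_bimodule (M j j) (M i j) (M j k)) (M i k)"
    and phi_left_canonical:
      "\<lbrakk>i \<in> {1..n}; j \<in> {1..n}; r \<in> carrier (M i i); a \<in> carrier (M i j)\<rbrakk>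
        \<Longrightarrow> gcomp M \<phi> i i j r a = lsmul (M i j) r a"
    and phi_left_iso:
      "\<lbrakk>i \<in> {1..n}; j \<in> {1..n}\<rbrakk>
        \<Longrightarrow> \<phi> i i j \<in> bimodule_iso (M i i) (M j j)
              (tensor_bimodule (M i i) (M i i) (M i j)) (M i j)"
    and phi_right_canonical:
      "\<lbrakk>i \<in> {1..n}; j \<in> {1..n}; a \<in> carrier (M i j); s \<in> carrier (M j j)\<rbrakk>
        \<Longrightarrow> gcomp M \<phi> i j j a s = rsmul (M i j) a s"
    and phi_right_iso:
      "\<lbrakk>i \<in> {1..n}; j \<in> {1..n}\<rbrakk>
        \<Longrightarrow> \<phi> i j j \<in> bimodule_iso (M i i) (M j j)
              (tensor_bimodule (M j j) (M i j) (M j j)) (M i j)"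
    and faithful:
      "\<lbrakk>i \<in> {1..n}; j \<in> {1..n}; i \<noteq> j\<rbrakk>
        \<Longrightarrow> faithful_left (M i i) (M i j) \<and> faithful_right (M j j) (M i j)"
    and nondegenerate:
      "\<lbrakk>i \<in> {1..n}; j \<in> {1..n}; i \<noteq> j; a \<in> carrier (M i j);
        \<forall>r \<in> carrier (M i i). \<forall>s \<in> carrier (M j j).
          rsmul (M i j) (lsmul (M i j) r a) s = \<zero>\<^bsub>M i j\<^esub>\<rbrakk>
        \<Longrightarrow> a = \<zero>\<^bsub>M i j\<^esub>"
    and gcomp_assoc:
      "\<lbrakk>i \<in> {1..n}; k \<in> {1..n}; l \<in> {1..n}; j \<in> {1..n};
        a \<in> carrier (M i k); b \<in> carrier (M k l); c \<in> carrier (M l j)\<rbrakk>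
        \<Longrightarrow> gcomp M \<phi> i k j a (gcomp M \<phi> k l j b c) = gcomp M \<phi> i l j (gcomp M \<phi> i k l a b) c"

text \<open>
  Matrices are extensional functions on index pairs, so that equality of matrices is equality
  of entries.
\<close>

definition gmat_ring :: "nat \<Rightarrow> 'a bimod_family \<Rightarrow> 'a tensor_maps \<Rightarrow> 'a gmat ring" where
  "gmat_ring n M \<phi> =
    \<lparr>carrier = (\<Pi>\<^sub>E (i, j) \<in> {1..n} \<times> {1..n}. carrier (M i j)),
     mult = (\<lambda>X Y. \<lambda>(i, j) \<in> {1..n} \<times> {1..n}.
       \<Oplus>\<^bsub>M i j\<^esub> k \<in> {1..n}. gcomp M \<phi> i k j (X (i, k)) (Y (k, j))),
     one = undefined,
     zero = (\<lambda>(i, j) \<in> {1..n} \<times> {1..n}. \<zero>\<^bsub>M i j\<^esub>),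
     add = (\<lambda>X Y. \<lambda>(i, j) \<in> {1..n} \<times> {1..n}. X (i, j) \<oplus>\<^bsub>M i j\<^esub> Y (i, j))\<rparr>"

definition gmat_component ::
    "nat \<Rightarrow> 'a bimod_family \<Rightarrow> 'a tensor_maps \<Rightarrow> nat \<Rightarrow> nat \<Rightarrow> 'a gmat set" where
  "gmat_component n M \<phi> i j =
    {X \<in> carrier (gmat_ring n M \<phi>).
      \<forall>k \<in> {1..n}. \<forall>l \<in> {1..n}. (k, l) \<noteq> (i, j) \<longrightarrow> X (k, l) = \<zero>\<^bsub>M k l\<^esub>}"

definition biadditive :: "('a, 'b) ring_scheme \<Rightarrow> ('a \<Rightarrow> 'a \<Rightarrow> 'a) \<Rightarrow> bool" where
  "biadditive G B \<longleftrightarrow>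
    B \<in> carrier G \<rightarrow> carrier G \<rightarrow> carrier G \<and>
    (\<forall>x \<in> carrier G. \<forall>y \<in> carrier G. \<forall>z \<in> carrier G.
      B (x \<oplus>\<^bsub>G\<^esub> y) z = B x z \<oplus>\<^bsub>G\<^esub> B y z \<and> B z (x \<oplus>\<^bsub>G\<^esub> y) = B z x \<oplus>\<^bsub>G\<^esub> B z y)"

definition image2 :: "('a \<Rightarrow> 'b \<Rightarrow> 'c) \<Rightarrow> 'a set \<Rightarrow> 'b set \<Rightarrow> 'c set" where
  "image2 B X Y = {B x y | x y. x \<in> X \<and> y \<in> Y}"

end

theory Submission
  imports Defs
begin

text \<open>
  Call \<open>u\<close> annihilating if \<open>B u z = B z u = 0\<close> for all off-diagonal \<open>z\<close>.  For a diagonal such \<open>u\<close>,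
  hypothesis (iv) makes \<open>u\<close> with the sign of its last entry changed central, and by faithfulness
  the diagonal entries of a central element vanish all together or not at all.  So an annihilating
  element of \<open>G\<^sub>n\<^sub>n\<close> is zero.  If \<open>u\<close> is diagonal and \<open>u\<close> and all \<open>B u s\<close> with \<open>s\<close> in \<open>G\<^sub>n\<^sub>n\<close> are
  annihilating, then \<open>B u s = 0\<close>, hence \<open>u\<^sub>n\<^sub>n = 0\<close> by (v) and (iii), and therefore \<open>u = 0\<close>.

  That a value \<open>u\<close> of \<open>f\<close> is diagonal follows from (ii) once \<open>B t (B u s) = 0\<close> for \<open>t\<close> in \<open>G\<^sub>r\<^sub>r\<close>,
  \<open>r < n\<close>, and \<open>s\<close> in \<open>G\<^sub>n\<^sub>n\<close>.  This is applied to \<open>f t y\<close> with \<open>y\<close> off-diagonal, then to \<open>f x y\<close>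
  with both arguments off-diagonal (where (vi) reduces it to the previous case), and finally to
  arbitrary arguments, since \<open>B z x\<close> and \<open>B x z\<close> are off-diagonal whenever \<open>z\<close> is.
\<close>

section \<open>Entries of generalized matrices\<close>

lemma (in abelian_group) zero_if_double:
  "x \<in> carrier G \<Longrightarrow> x \<oplus> x = x \<Longrightarrow> x = \<zero>"
  by (metis add.l_cancel_one')

lemma (in nonunital_bimodule) lsmul_zero_left:
  assumes "x \<in> carrier M" shows "lsmul M \<zero>\<^bsub>R\<^esub> x = \<zero>\<^bsub>M\<^esub>"
  using lsmul_l_distr[of "\<zero>\<^bsub>R\<^esub>" "\<zero>\<^bsub>R\<^esub>" x] assms lsmul_closed
  by (intro M.zero_if_double) auto

lemma (in nonunital_bimodule) rsmul_zero_right: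
  assumes "x \<in> carrier M" shows "rsmul M x \<zero>\<^bsub>S\<^esub> = \<zero>\<^bsub>M\<^esub>"
  using rsmul_r_distr[of x "\<zero>\<^bsub>S\<^esub>" "\<zero>\<^bsub>S\<^esub>"] assms rsmul_closed
  by (intro M.zero_if_double) auto

lemma elem_tensor_closed:
  assumes "nonunital_bimodule R S M" "nonunital_bimodule S T N"
    and "x \<in> carrier M" "y \<in> carrier N"
  shows "elem_tensor S M N x y \<in> carrier (tensor_bimodule S M N)"
  using assms(3,4) by (auto simp: elem_tensor_def tensor_bimodule_def Let_def FactGroup_def
      RCOSETS_def tensor_free_def)

context generalized_matrix_ring
begin

abbreviation "G \<equiv> gmat_ring n M \<phi>"
abbreviation "C \<equiv> gmat_component n M \<phi>"

lemma entry_group: "\<lbrakk>i \<in> {1..n}; j \<in> {1..n}\<rbrakk> \<Longrightarrow> abelian_group (M i j)"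
  using bimodules by (auto dest: nonunital_bimodule.axioms)

lemma gcomp_closed:
  assumes "i \<in> {1..n}" "j \<in> {1..n}" "k \<in> {1..n}" "a \<in> carrier (M i j)" "b \<in> carrier (M j k)"
  shows "gcomp M \<phi> i j k a b \<in> carrier (M i k)"
  using phi_hom[OF assms(1-3)] elem_tensor_closed[OF bimodules bimodules assms(4,5)] assms(1-3)
  by (auto simp: gcomp_def bimodule_hom_def)

text \<open>The tensor of \<open>a\<close> with zero is fixed by the right action of the zero of
  \<open>M k k\<close>, because that zero sends the second factor to itself. The bimodule map
  \<open>\<phi> i j k\<close> carries this action over to \<open>M i k\<close>, where zero
  annihilates everything. In this way no sum of cosets has to be computed.\<close>

lemma gcomp_zero_right:
  assumes ijk: "i \<in> {1..n}" "j \<in> {1..n}" "k \<in> {1..n}" and a: "a \<in> carrier (M i j)"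
  shows "gcomp M \<phi> i j k a \<zero>\<^bsub>M j k\<^esub> = \<zero>\<^bsub>M i k\<^esub>"
proof -
  interpret jk: nonunital_bimodule "M j j" "M k k" "M j k" using bimodules ijk by blast
  interpret ik: nonunital_bimodule "M i i" "M k k" "M i k" using bimodules ijk by blast
  note bim = bimodules[OF ijk(1,2)] bimodules[OF ijk(2,3)]
  let ?T = "tensor_bimodule (M j j) (M i j) (M j k)"
  let ?e = "elem_tensor (M j j) (M i j) (M j k) a \<zero>\<^bsub>M j k\<^esub>"
  have "?e = rsmul ?T ?e \<zero>\<^bsub>M k k\<^esub>"
    using rsmul_elem_tensor[OF bim a jk.M.zero_closed jk.S.zero_closed]
    by (simp add: jk.rsmul_zero_right)
  moreover have "\<phi> i j k (rsmul ?T ?e \<zero>\<^bsub>M k k\<^esub>) = rsmul (M i k) (\<phi> i j k ?e) \<zero>\<^bsub>M k k\<^esub>"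
    using phi_hom[OF ijk] elem_tensor_closed[OF bim a jk.M.zero_closed]
    by (auto simp: bimodule_hom_def)
  ultimately show ?thesis
    using gcomp_closed[OF ijk a jk.M.zero_closed] ik.rsmul_zero_right
    by (metis gcomp_def)
qed

text \<open>The same argument on the other side, with the zero of \<open>M i i\<close> acting from
  the left.\<close>

lemma gcomp_zero_left:
  assumes ijk: "i \<in> {1..n}" "j \<in> {1..n}" "k \<in> {1..n}" and b: "b \<in> carrier (M j k)"
  shows "gcomp M \<phi> i j k \<zero>\<^bsub>M i j\<^esub> b = \<zero>\<^bsub>M i k\<^esub>"
proof -
  interpret ij: nonunital_bimodule "M i i" "M j j" "M i j" using bimodules ijk by blast
  interpret ik: nonunital_bimodule "M i i" "M k k" "M i k" using bimodules ijk by blast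
  note bim = bimodules[OF ijk(1,2)] bimodules[OF ijk(2,3)]
  let ?T = "tensor_bimodule (M j j) (M i j) (M j k)"
  let ?e = "elem_tensor (M j j) (M i j) (M j k) \<zero>\<^bsub>M i j\<^esub> b"
  have "?e = lsmul ?T \<zero>\<^bsub>M i i\<^esub> ?e"
    using lsmul_elem_tensor[OF bim ij.R.zero_closed ij.M.zero_closed b]
    by (simp add: ij.lsmul_zero_left)
  moreover have "\<phi> i j k (lsmul ?T \<zero>\<^bsub>M i i\<^esub> ?e) = lsmul (M i k) \<zero>\<^bsub>M i i\<^esub> (\<phi> i j k ?e)"
    using phi_hom[OF ijk] elem_tensor_closed[OF bim ij.M.zero_closed b]
    by (auto simp: bimodule_hom_def)
  ultimately show ?thesis
    using gcomp_closed[OF ijk ij.M.zero_closed b] ik.lsmul_zero_left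
    by (metis gcomp_def)
qed

section \<open>The additive group of matrices, entry by entry\<close>

lemma gmat_entry_closed:
  "\<lbrakk>X \<in> carrier G; i \<in> {1..n}; j \<in> {1..n}\<rbrakk> \<Longrightarrow> X (i, j) \<in> carrier (M i j)"
  by (fastforce simp: gmat_ring_def dest: PiE_mem)

lemma gmat_eqI:
  assumes "X \<in> carrier G" "Y \<in> carrier G"
    and "\<And>i j. \<lbrakk>i \<in> {1..n}; j \<in> {1..n}\<rbrakk> \<Longrightarrow> X (i, j) = Y (i, j)"
  shows "X = Y"
  using assms by (intro PiE_ext[of X _ _ Y]) (auto simp: gmat_ring_def)

lemma gmat_zero_entry: "\<lbrakk>i \<in> {1..n}; j \<in> {1..n}\<rbrakk> \<Longrightarrow> \<zero>\<^bsub>G\<^esub> (i, j) = \<zero>\<^bsub>M i j\<^esub>"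
  by (simp add: gmat_ring_def)

lemma gmat_add_entry:
  "\<lbrakk>i \<in> {1..n}; j \<in> {1..n}\<rbrakk> \<Longrightarrow> (X \<oplus>\<^bsub>G\<^esub> Y) (i, j) = X (i, j) \<oplus>\<^bsub>M i j\<^esub> Y (i, j)"
  by (simp add: gmat_ring_def)

lemma gmat_mult_entry:
  "\<lbrakk>i \<in> {1..n}; j \<in> {1..n}\<rbrakk> \<Longrightarrow>
    (X \<otimes>\<^bsub>G\<^esub> Y) (i, j) = (\<Oplus>\<^bsub>M i j\<^esub> k \<in> {1..n}. gcomp M \<phi> i k j (X (i, k)) (Y (k, j)))"
  by (simp add: gmat_ring_def)

lemma gmat_abelian_group: "abelian_group G"
proof (rule abelian_groupI)
  fix X Y Z assume X: "X \<in> carrier G" and Y: "Y \<in> carrier G" and Z: "Z \<in> carrier G"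
  have cl: "V \<oplus>\<^bsub>G\<^esub> W \<in> carrier G" if "V \<in> carrier G" "W \<in> carrier G" for V W
    using gmat_entry_closed[OF that(1)] gmat_entry_closed[OF that(2)] entry_group
    by (auto simp: gmat_ring_def intro!: abelian_groupE(1))
  show "X \<oplus>\<^bsub>G\<^esub> Y \<in> carrier G" by (rule cl[OF X Y])
  show "X \<oplus>\<^bsub>G\<^esub> Y \<oplus>\<^bsub>G\<^esub> Z = X \<oplus>\<^bsub>G\<^esub> (Y \<oplus>\<^bsub>G\<^esub> Z)"
    using X Y Z cl entry_group
    by (intro gmat_eqI) (auto simp: gmat_add_entry gmat_entry_closed intro!: abelian_groupE(3))
  show "X \<oplus>\<^bsub>G\<^esub> Y = Y \<oplus>\<^bsub>G\<^esub> X"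
    using X Y cl entry_group
    by (intro gmat_eqI) (auto simp: gmat_add_entry gmat_entry_closed intro!: abelian_groupE(4))
next
  show Z: "\<zero>\<^bsub>G\<^esub> \<in> carrier G"
    using entry_group by (auto simp: gmat_ring_def intro!: abelian_groupE(2))
  fix X assume X: "X \<in> carrier G"
  have "\<zero>\<^bsub>G\<^esub> \<oplus>\<^bsub>G\<^esub> X \<in> carrier G"
    using gmat_entry_closed[OF X] gmat_entry_closed[OF Z] entry_group
    by (auto simp: gmat_ring_def intro!: abelian_groupE(1) abelian_groupE(2))
  then show "\<zero>\<^bsub>G\<^esub> \<oplus>\<^bsub>G\<^esub> X = X"
    using X entry_group
    by (intro gmat_eqI) (auto simp: gmat_add_entry gmat_zero_entry gmat_entry_closed
        intro!: abelian_groupE(5))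
  let ?Y = "\<lambda>(i, j) \<in> {1..n} \<times> {1..n}. \<ominus>\<^bsub>M i j\<^esub> X (i, j)"
  have Y: "?Y \<in> carrier G"
    using gmat_entry_closed[OF X] entry_group
    by (auto simp: gmat_ring_def intro!: abelian_group.a_inv_closed)
  moreover have "?Y \<oplus>\<^bsub>G\<^esub> X \<in> carrier G"
    using gmat_entry_closed[OF X] gmat_entry_closed[OF Y] entry_group
    by (auto simp: gmat_ring_def
        intro!: abelian_groupE(1) abelian_group.a_inv_closed)
  then have "?Y \<oplus>\<^bsub>G\<^esub> X = \<zero>\<^bsub>G\<^esub>"
    using X Z entry_group
    by (intro gmat_eqI) (auto simp: gmat_add_entry gmat_zero_entry gmat_entry_closed
        intro!: abelian_group.l_neg)
  ultimately show "\<exists>Y \<in> carrier G. Y \<oplus>\<^bsub>G\<^esub> X = \<zero>\<^bsub>G\<^esub>" by blast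
qed

sublocale gmat: abelian_group G
  by (rule gmat_abelian_group)

lemma gmat_minus_entry:
  assumes "X \<in> carrier G" "i \<in> {1..n}" "j \<in> {1..n}"
  shows "(\<ominus>\<^bsub>G\<^esub> X) (i, j) = \<ominus>\<^bsub>M i j\<^esub> X (i, j)"
proof -
  interpret abelian_group "M i j" using entry_group assms by blast
  have "(\<ominus>\<^bsub>G\<^esub> X) (i, j) \<oplus>\<^bsub>M i j\<^esub> X (i, j) = \<zero>\<^bsub>M i j\<^esub>"
    using assms gmat.l_neg[of X] by (metis gmat_add_entry gmat_zero_entry)
  then show ?thesis
    using assms by (intro minus_equality[symmetric]) (auto simp: gmat_entry_closed)
qed

lemma entry_minus_zero:
  assumes "i \<in> {1..n}" "j \<in> {1..n}" shows "\<ominus>\<^bsub>M i j\<^esub> \<zero>\<^bsub>M i j\<^esub> = \<zero>\<^bsub>M i j\<^esub>"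
proof -
  interpret abelian_group "M i j" using entry_group assms by blast
  show ?thesis by (rule minus_equality) simp_all
qed

lemma gmat_finsum_entry:
  assumes "F \<in> A \<rightarrow> carrier G" "i \<in> {1..n}" "j \<in> {1..n}"
  shows "(\<Oplus>\<^bsub>G\<^esub> k \<in> A. F k) (i, j) = (\<Oplus>\<^bsub>M i j\<^esub> k \<in> A. F k (i, j))"
proof -
  interpret abelian_group "M i j" using entry_group assms by blast
  show ?thesis
  proof (cases "finite A")
    case True
    then show ?thesis using assms(1)
    proof (induction A)
      case (insert a A)
      then have "(\<lambda>k. F k (i, j)) \<in> A \<rightarrow> carrier (M i j)" "F a (i, j) \<in> carrier (M i j)"
        using gmat_entry_closed assms(2,3) by auto
      with insert show ?case by (simp add: gmat_add_entry[OF assms(2,3)] Pi_def)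
    qed (simp add: gmat_zero_entry[OF assms(2,3)])
  \<comment> \<open>For infinite \<open>A\<close> both sums take the default value zero.\<close>
  qed (simp add: gmat_zero_entry[OF assms(2,3)] finsum_infinite)
qed

section \<open>Matrices with prescribed support\<close>

text \<open>Allowing every set of index pairs treats the components, the diagonal
  (\<open>Id\<close>) and the off-diagonal part (\<open>- Id\<close>) uniformly, with intersections
  and complements of supports at hand. Pairs outside the index range impose nothing.\<close>

definition supported :: "(nat \<times> nat) set \<Rightarrow> 'a gmat set" where
  "supported S = {X \<in> carrier G. \<forall>i \<in> {1..n}. \<forall>j \<in> {1..n}. (i, j) \<notin> S \<longrightarrow> X (i, j) = \<zero>\<^bsub>M i j\<^esub>}"

definition restrict_entries :: "(nat \<times> nat) set \<Rightarrow> 'a gmat \<Rightarrow> 'a gmat" where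
  "restrict_entries S X =
    (\<lambda>(i, j) \<in> {1..n} \<times> {1..n}. if (i, j) \<in> S then X (i, j) else \<zero>\<^bsub>M i j\<^esub>)"

lemma component_eq_supported: "C p q = supported {(p, q)}"
  by (auto simp: gmat_component_def supported_def)

lemma supported_carrier: "X \<in> supported S \<Longrightarrow> X \<in> carrier G"
  by (simp add: supported_def)

lemma supported_entry:
  "\<lbrakk>X \<in> supported S; (i, j) \<notin> S; i \<in> {1..n}; j \<in> {1..n}\<rbrakk> \<Longrightarrow> X (i, j) = \<zero>\<^bsub>M i j\<^esub>"
  by (simp add: supported_def)

lemma supported_mono: "S \<subseteq> T \<Longrightarrow> supported S \<subseteq> supported T"
  by (auto simp: supported_def)

lemma supported_Int: "supported S \<inter> supported T = supported (S \<inter> T)"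
  by (auto simp: supported_def)

lemma supported_empty: "supported {} = {\<zero>\<^bsub>G\<^esub>}"
  by (auto simp: supported_def gmat_zero_entry intro: gmat_eqI)

lemma supported_disjoint:
  "\<lbrakk>X \<in> supported S; X \<in> supported T; S \<inter> T = {}\<rbrakk> \<Longrightarrow> X = \<zero>\<^bsub>G\<^esub>"
  using supported_Int[of S T] supported_empty by auto

lemma zero_supported: "\<zero>\<^bsub>G\<^esub> \<in> supported S"
  by (simp add: supported_def gmat_zero_entry)

lemma add_supported:
  assumes "X \<in> supported S" "Y \<in> supported S" shows "X \<oplus>\<^bsub>G\<^esub> Y \<in> supported S"
  using assms entry_group
  by (auto simp: supported_def gmat_add_entry intro!: abelian_groupE(5) abelian_groupE(2))

lemma minus_supported: "X \<in> supported S \<Longrightarrow> \<ominus>\<^bsub>G\<^esub> X \<in> supported S"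
  by (simp add: supported_def gmat_minus_entry entry_minus_zero)

lemma restrict_entries_entry:
  "\<lbrakk>i \<in> {1..n}; j \<in> {1..n}\<rbrakk> \<Longrightarrow>
    restrict_entries S X (i, j) = (if (i, j) \<in> S then X (i, j) else \<zero>\<^bsub>M i j\<^esub>)"
  by (simp add: restrict_entries_def)

lemma restrict_entries_supported:
  assumes "X \<in> carrier G" shows "restrict_entries S X \<in> supported S"
  using gmat_entry_closed[OF assms] entry_group
  by (auto simp: supported_def restrict_entries_def gmat_ring_def intro!: abelian_groupE(2))

lemma restrict_entries_closed: "X \<in> carrier G \<Longrightarrow> restrict_entries S X \<in> carrier G"
  using restrict_entries_supported supported_carrier by blast

lemma restrict_entries_split:
  assumes "X \<in> carrier G"
  shows "X = restrict_entries S X \<oplus>\<^bsub>G\<^esub> restrict_entries (- S) X"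
proof (rule gmat_eqI)
  fix i j assume ij: "i \<in> {1..n}" "j \<in> {1..n}"
  interpret abelian_group "M i j" using entry_group ij by blast
  show "X (i, j) = (restrict_entries S X \<oplus>\<^bsub>G\<^esub> restrict_entries (- S) X) (i, j)"
    using ij gmat_entry_closed[OF assms ij] by (simp add: gmat_add_entry restrict_entries_entry)
qed (use assms restrict_entries_closed in auto)

text \<open>Only the summand indexed by \<open>(i, j)\<close> contributes to the entry at
  \<open>(i, j)\<close>; if \<open>(i, j)\<close> lies outside \<open>S\<close>, both sides are zero
  there.\<close>

lemma supported_eq_finsum:
  assumes X: "X \<in> supported S" and S: "S \<subseteq> {1..n} \<times> {1..n}"
  shows "X = (\<Oplus>\<^bsub>G\<^esub> pq \<in> S. restrict_entries {pq} X)"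
proof (rule gmat_eqI)
  have fin: "finite S" using S finite_subset by blast
  note XG = supported_carrier[OF X]
  have F: "(\<lambda>pq. restrict_entries {pq} X) \<in> S \<rightarrow> carrier G"
    using restrict_entries_closed[OF XG] by blast
  then show "(\<Oplus>\<^bsub>G\<^esub> pq \<in> S. restrict_entries {pq} X) \<in> carrier G" by (rule gmat.finsum_closed)
  fix i j assume ij: "i \<in> {1..n}" "j \<in> {1..n}"
  interpret abelian_group "M i j" using entry_group ij by blast
  have "(\<Oplus>\<^bsub>G\<^esub> pq \<in> S. restrict_entries {pq} X) (i, j)
      = (\<Oplus>\<^bsub>M i j\<^esub> pq \<in> S. if (i, j) = pq then X (i, j) else \<zero>\<^bsub>M i j\<^esub>)"
    using ij by (auto simp: gmat_finsum_entry[OF F ij] restrict_entries_entry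
        gmat_entry_closed[OF XG] intro!: finsum_cong')
  also have "\<dots> = X (i, j)"
  proof (cases "(i, j) \<in> S")
    case True
    then show ?thesis
      using finsum_singleton[OF True fin, of "\<lambda>_. X (i, j)"] gmat_entry_closed[OF XG ij] by simp
  next
    case False
    then have "(\<Oplus>\<^bsub>M i j\<^esub> pq \<in> S. if (i, j) = pq then X (i, j) else \<zero>\<^bsub>M i j\<^esub>)
        = (\<Oplus>\<^bsub>M i j\<^esub> pq \<in> S. \<zero>\<^bsub>M i j\<^esub>)"
      by (intro finsum_cong') auto
    with False show ?thesis using supported_entry[OF X False ij] by simp
  qed
  finally show "X (i, j) = (\<Oplus>\<^bsub>G\<^esub> pq \<in> S. restrict_entries {pq} X) (i, j)" by simp
qed (rule supported_carrier[OF X])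

text \<open>\<open>X\<close> is the finite sum of its single-entry restrictions, so additive
  properties need checking on components only. This is how conditions on \<open>B\<close> between
  components are extended to arbitrary supports. As \<open>S\<close> may reach outside the index
  range, the sum is built up over subsets of the part inside it.\<close>

lemma supported_induct [consumes 1, case_names zero component add]:
  assumes X: "X \<in> supported S"
    and zero: "P \<zero>\<^bsub>G\<^esub>"
    and component: "\<And>p q Y. \<lbrakk>p \<in> {1..n}; q \<in> {1..n}; (p, q) \<in> S; Y \<in> C p q\<rbrakk> \<Longrightarrow> P Y"
    and add: "\<And>Y Z. \<lbrakk>Y \<in> carrier G; Z \<in> carrier G; P Y; P Z\<rbrakk> \<Longrightarrow> P (Y \<oplus>\<^bsub>G\<^esub> Z)"
  shows "P X"
proof -
  let ?S = "S \<inter> {1..n} \<times> {1..n}"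
  note XG = supported_carrier[OF X]
  have "P (\<Oplus>\<^bsub>G\<^esub> pq \<in> A. restrict_entries {pq} X)" if "finite A" "A \<subseteq> ?S" for A
    using that
  proof (induction A)
    case empty
    then show ?case by (simp add: zero)
  next
    case (insert pq A)
    obtain p q where pq: "pq = (p, q)" by (cases pq)
    then have "P (restrict_entries {pq} X)"
      using insert.prems restrict_entries_supported[OF XG, of "{pq}"]
      by (intro component[of p q]) (auto simp: component_eq_supported)
    then show ?case
      using insert restrict_entries_closed[OF XG] by (auto intro!: add)
  qed
  moreover have "X \<in> supported ?S" using X by (auto simp: supported_def)
  moreover have "finite ?S" by simp
  ultimately show ?thesis using supported_eq_finsum[of X ?S] by (metis inf_le2 order_refl)
qed

section \<open>Diagonal entries of central matrices\<close>

text \<open>Compare the \<open>(p, q)\<close> entries of the two products of \<open>c\<close> with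
  the matrix \<open>?A\<close> whose only possibly nonzero entry is \<open>a\<close> at
  \<open>(p, q)\<close>. On one side only \<open>k = p\<close> survives, on the other only
  \<open>k = q\<close>, and the canonical maps turn these terms into module actions. Off-diagonal
  entries of \<open>c\<close> only meet zeros of \<open>?A\<close>.\<close>

lemma center_entries:
  assumes c: "c \<in> ring_center G" and p: "p \<in> {1..n}" and q: "q \<in> {1..n}"
    and a: "a \<in> carrier (M p q)"
  shows "lsmul (M p q) (c (p, p)) a = rsmul (M p q) a (c (q, q))"
proof -
  interpret pq: abelian_group "M p q" using entry_group p q by blast
  let ?A = "\<lambda>(i, j) \<in> {1..n} \<times> {1..n}. if (i, j) = (p, q) then a else \<zero>\<^bsub>M i j\<^esub>"
  have A: "?A \<in> carrier G"
    using a entry_group by (auto simp: gmat_ring_def intro!: abelian_groupE(2))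
  have cG: "c \<in> carrier G" and comm: "c \<otimes>\<^bsub>G\<^esub> ?A = ?A \<otimes>\<^bsub>G\<^esub> c"
    using c A by (auto simp: ring_center_def)
  note cc = gmat_entry_closed[OF cG]
  have "(c \<otimes>\<^bsub>G\<^esub> ?A) (p, q)
      = (\<Oplus>\<^bsub>M p q\<^esub> k \<in> {1..n}. if p = k then gcomp M \<phi> p k q (c (p, k)) (?A (k, q)) else \<zero>\<^bsub>M p q\<^esub>)"
    using p q a cc
    by (auto simp: gmat_mult_entry gcomp_zero_right entry_group abelian_groupE(2)
        intro!: pq.finsum_cong' gcomp_closed)
  also have "\<dots> = gcomp M \<phi> p p q (c (p, p)) (?A (p, q))"
    by (rule pq.finsum_singleton) (use p q a cc entry_group in \<open>auto simp: abelian_groupE(2) intro!: gcomp_closed\<close>)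
  also have "\<dots> = lsmul (M p q) (c (p, p)) a"
    using p q cc a by (simp add: phi_left_canonical)
  finally have l: "(c \<otimes>\<^bsub>G\<^esub> ?A) (p, q) = lsmul (M p q) (c (p, p)) a" .
  have "(?A \<otimes>\<^bsub>G\<^esub> c) (p, q)
      = (\<Oplus>\<^bsub>M p q\<^esub> k \<in> {1..n}. if q = k then gcomp M \<phi> p k q (?A (p, k)) (c (k, q)) else \<zero>\<^bsub>M p q\<^esub>)"
    using p q a cc
    by (auto simp: gmat_mult_entry gcomp_zero_left entry_group abelian_groupE(2)
        intro!: pq.finsum_cong' gcomp_closed)
  also have "\<dots> = gcomp M \<phi> p q q (?A (p, q)) (c (q, q))"
    by (rule pq.finsum_singleton) (use p q a cc entry_group in \<open>auto simp: abelian_groupE(2) intro!: gcomp_closed\<close>)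
  also have "\<dots> = rsmul (M p q) a (c (q, q))"
    using p q cc a by (simp add: phi_right_canonical)
  finally show ?thesis using l comm by simp
qed

text \<open>If one of the two entries is zero, \<open>center_entries\<close> shows that the other
  annihilates all of \<open>M p q\<close>, and faithfulness on the corresponding side makes it
  zero.\<close>

lemma center_diagonal_eq_zero_iff:
  assumes c: "c \<in> ring_center G" and pq: "p \<in> {1..n}" "q \<in> {1..n}" "p \<noteq> q"
  shows "c (p, p) = \<zero>\<^bsub>M p p\<^esub> \<longleftrightarrow> c (q, q) = \<zero>\<^bsub>M q q\<^esub>"
proof -
  interpret nonunital_bimodule "M p p" "M q q" "M p q" using bimodules pq by blast
  have "c \<in> carrier G" using c by (simp add: ring_center_def)
  then have "c (p, p) \<in> carrier (M p p)" "c (q, q) \<in> carrier (M q q)"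
    using pq gmat_entry_closed by auto
  then show ?thesis
    using faithful[OF pq] center_entries[OF c pq(1,2)] lsmul_zero_left rsmul_zero_right
    unfolding faithful_left_def faithful_right_def by metis
qed

text \<open>Hypotheses (iv) and (v) sum over single indices \<open>p\<close>, whereas supports are
  sets of pairs; reindexing along the diagonal passes from one to the other.\<close>

lemma restrict_entries_diag_eq_finsum:
  assumes u: "u \<in> carrier G" and A: "A \<subseteq> {1..n}"
  shows "(\<Oplus>\<^bsub>G\<^esub> p \<in> A. restrict_entries {(p, p)} u) = restrict_entries (Id_on A) u"
proof -
  let ?h = "\<lambda>p. (p, p)"
  have A_img: "Id_on A = ?h ` A" by auto
  note v = restrict_entries_closed[OF u, of "Id_on A"]
  have eq: "restrict_entries {(p, p)} (restrict_entries (Id_on A) u) = restrict_entries {(p, p)} u"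
    if "p \<in> A" for p
    using that by (auto simp: restrict_entries_def fun_eq_iff)
  have "restrict_entries (Id_on A) u
      = (\<Oplus>\<^bsub>G\<^esub> pq \<in> ?h ` A. restrict_entries {pq} (restrict_entries (Id_on A) u))"
    unfolding A_img[symmetric]
    by (rule supported_eq_finsum[OF restrict_entries_supported[OF u]]) (use A in auto)
  also have "\<dots> = (\<Oplus>\<^bsub>G\<^esub> p \<in> A. restrict_entries {(p, p)} (restrict_entries (Id_on A) u))"
    by (rule gmat.finsum_reindex) (auto simp: inj_on_def restrict_entries_closed[OF v])
  also have "\<dots> = (\<Oplus>\<^bsub>G\<^esub> p \<in> A. restrict_entries {(p, p)} u)"
    by (rule gmat.finsum_cong') (auto simp: eq restrict_entries_closed[OF u])
  finally show ?thesis ..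
qed

lemma restrict_entries_id:
  assumes X: "X \<in> supported S" and S: "S \<inter> {1..n} \<times> {1..n} \<subseteq> T"
  shows "restrict_entries T X = X"
proof (rule gmat_eqI)
  fix i j assume ij: "i \<in> {1..n}" "j \<in> {1..n}"
  then have "(i, j) \<in> S \<Longrightarrow> (i, j) \<in> T" using S by blast
  then show "restrict_entries T X (i, j) = X (i, j)"
    using supported_entry[OF X _ ij]
    by (cases "(i, j) \<in> S") (simp_all add: restrict_entries_entry[OF ij])
qed (use supported_carrier[OF X] restrict_entries_closed in auto)

end

section \<open>Pairings compatible with the grading\<close>

text \<open>Here the finite sums over components are replaced by membership in
  \<open>supported\<close>, so that elements can be split by \<open>restrict_entries\<close> instead
  of being presented as sums. In \<open>off_left_faithful\<close> each diagonal component is tested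
  separately; by biadditivity this is the same as testing all their sums.\<close>

locale diagonal_pairing = generalized_matrix_ring n M \<phi>
  for n :: nat and M :: "'a bimod_family" and \<phi> +
  fixes B :: "'a gmat \<Rightarrow> 'a gmat \<Rightarrow> 'a gmat"
  assumes n_ge_2: "2 \<le> n"
    and biadd: "biadditive (gmat_ring n M \<phi>) B"
    and diag_diag: "\<lbrakk>p \<in> {1..n}; q \<in> {1..n}; x \<in> C p p; y \<in> C q q\<rbrakk> \<Longrightarrow> B x y \<in> C p p \<inter> C q q"
    and diag_off: "\<lbrakk>p \<in> {1..n}; r \<in> {1..n}; s \<in> {1..n}; r \<noteq> s; x \<in> C p p; y \<in> C r s\<rbrakk>
      \<Longrightarrow> B x y \<in> C r s \<and> B y x \<in> C r s"
    and off_off: "\<lbrakk>p \<in> {1..n}; q \<in> {1..n}; r \<in> {1..n}; s \<in> {1..n}; p \<noteq> q; r \<noteq> s;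
      x \<in> C p q; y \<in> C r s\<rbrakk> \<Longrightarrow> B x y = \<zero>\<^bsub>G\<^esub>"
    and off_right_faithful: "\<lbrakk>x \<in> supported (- Id); \<And>z. z \<in> C n n \<Longrightarrow> B x z = \<zero>\<^bsub>G\<^esub>\<rbrakk> \<Longrightarrow> x = \<zero>\<^bsub>G\<^esub>"
    and off_left_faithful: "\<lbrakk>x \<in> supported (- Id);
      \<And>r z. \<lbrakk>r \<in> {1..<n}; z \<in> C r r\<rbrakk> \<Longrightarrow> B z x = \<zero>\<^bsub>G\<^esub>\<rbrakk> \<Longrightarrow> x = \<zero>\<^bsub>G\<^esub>"
    and corner_faithful: "\<lbrakk>a \<in> C n n; \<And>z. z \<in> C n n \<Longrightarrow> B z a = \<zero>\<^bsub>G\<^esub>\<rbrakk> \<Longrightarrow> a = \<zero>\<^bsub>G\<^esub>"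
    and signed_central: "\<lbrakk>u \<in> supported Id;
      \<And>z. z \<in> supported (- Id) \<Longrightarrow> B u z = \<zero>\<^bsub>G\<^esub> \<and> B z u = \<zero>\<^bsub>G\<^esub>\<rbrakk>
      \<Longrightarrow> restrict_entries (Id_on {1..<n}) u \<oplus>\<^bsub>G\<^esub> \<ominus>\<^bsub>G\<^esub> restrict_entries {(n, n)} u \<in> ring_center G"
    and central_comm: "\<lbrakk>c \<in> supported Id; c \<in> ring_center G; p \<in> {1..n}; d \<in> C p p\<rbrakk>
      \<Longrightarrow> B (restrict_entries {(p, p)} c) d = B d (restrict_entries {(p, p)} c)"
    and pairing_assoc: "\<lbrakk>r \<in> {1..n}; k \<in> {1..n}; l \<in> {1..n}; k \<noteq> l;
      x \<in> C r r; y \<in> C k l; z \<in> C n n\<rbrakk> \<Longrightarrow> B x (B y z) = B (B x y) z"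
begin

section \<open>Consequences of biadditivity and of the grading\<close>

lemma B_closed: "\<lbrakk>x \<in> carrier G; y \<in> carrier G\<rbrakk> \<Longrightarrow> B x y \<in> carrier G"
  using biadd by (auto simp: biadditive_def)

lemma B_add_left:
  "\<lbrakk>x \<in> carrier G; y \<in> carrier G; z \<in> carrier G\<rbrakk> \<Longrightarrow> B (x \<oplus>\<^bsub>G\<^esub> y) z = B x z \<oplus>\<^bsub>G\<^esub> B y z"
  using biadd by (auto simp: biadditive_def)

lemma B_add_right:
  "\<lbrakk>x \<in> carrier G; y \<in> carrier G; z \<in> carrier G\<rbrakk> \<Longrightarrow> B z (x \<oplus>\<^bsub>G\<^esub> y) = B z x \<oplus>\<^bsub>G\<^esub> B z y"
  using biadd by (auto simp: biadditive_def)

lemma B_zero_left: "x \<in> carrier G \<Longrightarrow> B \<zero>\<^bsub>G\<^esub> x = \<zero>\<^bsub>G\<^esub>"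
  using B_add_left[of "\<zero>\<^bsub>G\<^esub>" "\<zero>\<^bsub>G\<^esub>" x] by (intro gmat.zero_if_double) (auto simp: B_closed)

lemma B_zero_right: "x \<in> carrier G \<Longrightarrow> B x \<zero>\<^bsub>G\<^esub> = \<zero>\<^bsub>G\<^esub>"
  using B_add_right[of "\<zero>\<^bsub>G\<^esub>" "\<zero>\<^bsub>G\<^esub>" x] by (intro gmat.zero_if_double) (auto simp: B_closed)

lemma B_minus_left:
  assumes "x \<in> carrier G" "y \<in> carrier G" shows "B (\<ominus>\<^bsub>G\<^esub> x) y = \<ominus>\<^bsub>G\<^esub> B x y"
  using assms B_add_left[of "\<ominus>\<^bsub>G\<^esub> x" x y]
  by (intro gmat.minus_equality[symmetric]) (auto simp: B_closed B_zero_left gmat.l_neg)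

lemma n_index: "n \<in> {1..n}"
  using n_ge_2 by simp

lemma component_carrier: "x \<in> C p q \<Longrightarrow> x \<in> carrier G"
  by (simp add: gmat_component_def)

lemma component_off: "\<lbrakk>x \<in> C p q; p \<noteq> q\<rbrakk> \<Longrightarrow> x \<in> supported (- Id)"
  using supported_mono[of "{(p, q)}" "- Id"] by (auto simp: component_eq_supported)

lemma component_diag: "x \<in> C p p \<Longrightarrow> x \<in> supported Id"
  using supported_mono[of "{(p, p)}" Id] by (auto simp: component_eq_supported)

lemma diag_diag_zero:
  assumes "p \<in> {1..n}" "q \<in> {1..n}" "p \<noteq> q" "x \<in> C p p" "y \<in> C q q"
  shows "B x y = \<zero>\<^bsub>G\<^esub>"
  using diag_diag[OF assms(1,2,4,5)] assms(3)
  by (auto simp: component_eq_supported intro: supported_disjoint)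

lemma B_off_off:
  assumes x: "x \<in> supported (- Id)" and y: "y \<in> supported (- Id)"
  shows "B x y = \<zero>\<^bsub>G\<^esub>"
  using y
proof (induction rule: supported_induct)
  case zero
  then show ?case using x by (simp add: B_zero_right supported_carrier)
next
  case y: (component r s y)
  from x show ?case
  proof (induction rule: supported_induct)
    case zero
    then show ?case using y by (simp add: B_zero_left component_carrier)
  next
    case (component p q x)
    with y show ?case by (auto intro: off_off)
  next
    case (add x x')
    then show ?case using y by (simp add: B_add_left component_carrier)
  qed
next
  case (add y y')
  then show ?case using x by (simp add: B_add_right supported_carrier)
qed

text \<open>The off-diagonal part absorbs products with anything: a diagonal component preserves
  each off-diagonal component, and an off-diagonal component sends it to zero.\<close>

lemma B_off:
  assumes x: "x \<in> carrier G" and y: "y \<in> supported (- Id)"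
  shows "B x y \<in> supported (- Id) \<and> B y x \<in> supported (- Id)"
  using y
proof (induction rule: supported_induct)
  case zero
  then show ?case using x by (simp add: B_zero_left B_zero_right zero_supported)
next
  case y: (component r s y)
  \<comment> \<open>With the full support, the component induction applies to an arbitrary
    \<open>x\<close>.\<close>
  have "x \<in> supported UNIV" using x by (simp add: supported_def)
  then show ?case
  proof (induction rule: supported_induct)
    case zero
    then show ?case
      using y by (simp add: B_zero_left B_zero_right component_carrier zero_supported)
  next
    case (component p q x)
    then show ?case
    proof (cases "p = q")
      case True
      with y component show ?thesis using diag_off[of p r s x y] component_off by auto
    next
      case False
      with y component show ?thesis
        using off_off[of p q r s x y] off_off[of r s p q y x] zero_supported by auto
    qed
  next
    case (add x x')
    then show ?case using y by (simp add: B_add_left B_add_right component_carrier add_supported)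
  qed
next
  case (add y y')
  then show ?case using x by (simp add: B_add_left B_add_right add_supported)
qed

lemma B_diag_corner:
  assumes "x \<in> supported Id" and s: "s \<in> C n n" shows "B x s \<in> C n n"
  using assms(1)
proof (induction rule: supported_induct)
  case zero
  then show ?case using s
    by (simp add: B_zero_left component_carrier component_eq_supported zero_supported)
next
  case (component p q x)
  then show ?case using diag_diag[OF _ n_index _ s] by auto
next
  case (add x x')
  then show ?case using s
    by (simp add: B_add_left component_carrier) (simp add: component_eq_supported add_supported)
qed

lemma B_upper_diag_corner:
  assumes "x \<in> supported (Id - {(n, n)})" and s: "s \<in> C n n" shows "B x s = \<zero>\<^bsub>G\<^esub>"
  using assms(1)
proof (induction rule: supported_induct)
  case zero
  then show ?case using s by (simp add: B_zero_left component_carrier)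
next
  case (component p q x)
  then show ?case using diag_diag_zero[OF _ n_index _ _ s] by auto
next
  case (add x x')
  then show ?case using s by (simp add: B_add_left component_carrier)
qed

text \<open>Both sides are additive in \<open>y\<close>, so hypothesis (vi) passes from one
  off-diagonal component to sums of them.\<close>

lemma pairing_assoc_off:
  assumes r: "r \<in> {1..n}" "x \<in> C r r" and y: "y \<in> supported (- Id)" and z: "z \<in> C n n"
  shows "B x (B y z) = B (B x y) z"
  using y
proof (induction rule: supported_induct)
  case zero
  then show ?case using r z by (simp add: B_zero_left B_zero_right component_carrier)
next
  case (component k l y)
  then show ?case using pairing_assoc r z by auto
next
  case (add y y')
  then show ?case using r z by (simp add: B_add_left B_add_right B_closed component_carrier)
qed

section \<open>Annihilators of the off-diagonal part\<close>

definition annihilates_off :: "'a gmat \<Rightarrow> bool" where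
  "annihilates_off u \<longleftrightarrow> (\<forall>z \<in> supported (- Id). B u z = \<zero>\<^bsub>G\<^esub> \<and> B z u = \<zero>\<^bsub>G\<^esub>)"

text \<open>The witness is the central element supplied by (iv). It is \<open>u\<close> with its
  corner negated, and its two descriptions serve different ends: the restriction to the corner is
  what (v) acts on, while the other diagonal entries are compared through
  \<open>center_diagonal_eq_zero_iff\<close>.\<close>

lemma signed_center:
  assumes u: "u \<in> supported Id" and ann: "annihilates_off u"
  obtains c where "c \<in> ring_center G" "c \<in> supported Id"
    "restrict_entries {(n, n)} c = \<ominus>\<^bsub>G\<^esub> restrict_entries {(n, n)} u"
    "\<forall>p \<in> {1..<n}. c (p, p) = u (p, p)"
proof
  let ?v = "restrict_entries (Id_on {1..<n}) u" and ?w = "restrict_entries {(n, n)} u"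
  let ?c = "?v \<oplus>\<^bsub>G\<^esub> \<ominus>\<^bsub>G\<^esub> ?w"
  note uG = supported_carrier[OF u]
  note rG = restrict_entries_closed[OF uG]
  show "?c \<in> ring_center G"
    using ann by (intro signed_central[OF u]) (auto simp: annihilates_off_def)
  show c: "?c \<in> supported Id"
    using restrict_entries_supported[OF uG, of "Id_on {1..<n}"]
      restrict_entries_supported[OF uG, of "{(n, n)}"]
      supported_mono[of "Id_on {1..<n}" Id] supported_mono[of "{(n, n)}" Id]
    by (intro add_supported minus_supported) auto
  show "restrict_entries {(n, n)} ?c = \<ominus>\<^bsub>G\<^esub> ?w"
  proof (rule gmat_eqI)
    interpret nn: abelian_group "M n n" using entry_group n_index by blast
    note nn = n_index n_index
    have "?c (n, n) = \<ominus>\<^bsub>M n n\<^esub> u (n, n)"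
      using gmat_entry_closed[OF uG nn]
      by (simp add: gmat_add_entry[OF nn] gmat_minus_entry[OF rG nn] restrict_entries_entry[OF nn]
          Id_on_iff)
    then have "restrict_entries {(n, n)} ?c (n, n) = (\<ominus>\<^bsub>G\<^esub> ?w) (n, n)"
      by (simp add: gmat_minus_entry[OF rG nn] restrict_entries_entry[OF nn])
    moreover fix i j assume ij: "i \<in> {1..n}" "j \<in> {1..n}"
    ultimately show "restrict_entries {(n, n)} ?c (i, j) = (\<ominus>\<^bsub>G\<^esub> ?w) (i, j)"
      using entry_minus_zero[OF ij]
      by (cases "(i, j) = (n, n)")
        (auto simp: gmat_minus_entry[OF rG ij] restrict_entries_entry[OF ij])
  qed (use rG c supported_carrier restrict_entries_closed in auto)
  show "\<forall>p \<in> {1..<n}. ?c (p, p) = u (p, p)"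
  proof
    fix p assume p: "p \<in> {1..<n}"
    then have pp: "p \<in> {1..n}" "p \<in> {1..n}" by simp_all
    interpret pp: abelian_group "M p p" using entry_group pp by blast
    show "?c (p, p) = u (p, p)"
      using p gmat_entry_closed[OF uG pp]
      by (simp add: gmat_add_entry[OF pp] gmat_minus_entry[OF rG pp] restrict_entries_entry[OF pp]
          entry_minus_zero[OF pp] Id_on_iff)
  qed
qed

text \<open>As \<open>n\<close> is at least 2, the index 1 differs from \<open>n\<close>. The
  central element attached to \<open>w\<close> therefore has the same \<open>(1, 1)\<close> entry as
  \<open>w\<close>, namely zero, which forces its corner, the negative of \<open>w\<close>, to
  vanish as well.\<close>

lemma corner_annihilator_zero:
  assumes w: "w \<in> C n n" and ann: "annihilates_off w"
  shows "w = \<zero>\<^bsub>G\<^esub>"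
proof -
  obtain c where c: "c \<in> ring_center G" "c \<in> supported Id"
    "restrict_entries {(n, n)} c = \<ominus>\<^bsub>G\<^esub> restrict_entries {(n, n)} w"
    "\<forall>p \<in> {1..<n}. c (p, p) = w (p, p)"
    by (rule signed_center[OF component_diag[OF w] ann])
  have one: "1 \<in> {1..<n}" "1 \<in> {1..n}" "1 \<noteq> n" using n_ge_2 by auto
  note w' = w[unfolded component_eq_supported]
  have "c (1, 1) = \<zero>\<^bsub>M 1 1\<^esub>"
    using bspec[OF c(4) one(1)] supported_entry[OF w', of 1 1] one by simp
  then have "c (n, n) = \<zero>\<^bsub>M n n\<^esub>"
    using center_diagonal_eq_zero_iff[OF c(1) one(2) n_index one(3)] by simp
  then have "restrict_entries {(n, n)} c = \<zero>\<^bsub>G\<^esub>"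
    by (auto simp: restrict_entries_def gmat_ring_def fun_eq_iff)
  moreover have "restrict_entries {(n, n)} w = w"
    using restrict_entries_id[OF w'] by simp
  ultimately show ?thesis
    using c(3) component_carrier[OF w] gmat.minus_minus[of w] gmat.minus_equality[of "\<zero>\<^bsub>G\<^esub>" "\<zero>\<^bsub>G\<^esub>"]
    by simp
qed

text \<open>The premise \<open>corner\<close> has \<open>u\<close> on the left of \<open>B\<close>,
  whereas (iii) needs the element on the right; (v) exchanges the two sides for the corner of the
  central element. Once that corner is zero, the remaining diagonal entries of the central element
  vanish, and these are the entries of \<open>u\<close>.\<close>

lemma diag_annihilator_zero:
  assumes u: "u \<in> supported Id" and ann: "annihilates_off u"
    and corner: "\<And>s. s \<in> C n n \<Longrightarrow> B u s = \<zero>\<^bsub>G\<^esub>"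
  shows "u = \<zero>\<^bsub>G\<^esub>"
proof -
  let ?w = "restrict_entries {(n, n)} u"
  note uG = supported_carrier[OF u]
  note wG = restrict_entries_closed[OF uG, of "{(n, n)}"]
  have wC: "?w \<in> C n n"
    using restrict_entries_supported[OF uG] by (simp add: component_eq_supported)
  obtain c where c: "c \<in> ring_center G" "c \<in> supported Id"
    "restrict_entries {(n, n)} c = \<ominus>\<^bsub>G\<^esub> ?w"
    "\<forall>p \<in> {1..<n}. c (p, p) = u (p, p)"
    by (rule signed_center[OF u ann])
  have Bw: "B ?w s = \<zero>\<^bsub>G\<^esub>" if s: "s \<in> C n n" for s
  proof -
    let ?v = "restrict_entries (- {(n, n)}) u"
    \<comment> \<open>Removing the corner from the diagonal \<open>u\<close> leaves entries
      \<open>(p, p)\<close> with \<open>p\<close> different from \<open>n\<close>, and those pair to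
      zero with the corner component.\<close>
    have v: "?v \<in> supported (Id - {(n, n)})"
      using restrict_entries_supported[OF uG, of "- {(n, n)}"] u
      by (auto simp: supported_def restrict_entries_entry)
    have "B u s = B ?w s \<oplus>\<^bsub>G\<^esub> B ?v s"
      using B_add_left[OF wG supported_carrier[OF v] component_carrier[OF s]]
        restrict_entries_split[OF uG, of "{(n, n)}"] by simp
    then show ?thesis
      using corner[OF s] B_upper_diag_corner[OF v s] B_closed[OF wG component_carrier[OF s]] by simp
  qed
  have zero: "\<ominus>\<^bsub>G\<^esub> \<zero>\<^bsub>G\<^esub> = \<zero>\<^bsub>G\<^esub>" by (rule gmat.minus_equality) simp_all
  \<comment> \<open>(iii) is applied to the negative of \<open>?w\<close>, because this is the
    corner of the central \<open>c\<close>, the element for which (v) gives commutation.\<close>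
  have "\<ominus>\<^bsub>G\<^esub> ?w = \<zero>\<^bsub>G\<^esub>"
  proof (rule corner_faithful)
    show "\<ominus>\<^bsub>G\<^esub> ?w \<in> C n n" using wC minus_supported by (simp add: component_eq_supported)
    fix s assume s: "s \<in> C n n"
    have "B s (\<ominus>\<^bsub>G\<^esub> ?w) = B (\<ominus>\<^bsub>G\<^esub> ?w) s"
      using central_comm[OF c(2,1) n_index s] c(3) by simp
    then show "B s (\<ominus>\<^bsub>G\<^esub> ?w) = \<zero>\<^bsub>G\<^esub>"
      using Bw[OF s] B_minus_left[OF wG component_carrier[OF s]] zero by simp
  qed
  then have w0: "?w = \<zero>\<^bsub>G\<^esub>" using gmat.minus_minus[OF wG] zero by simp
  then have un: "u (n, n) = \<zero>\<^bsub>M n n\<^esub>"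
    using restrict_entries_entry[OF n_index n_index, of "{(n, n)}" u] gmat_zero_entry[OF n_index n_index]
    by simp
  have "restrict_entries {(n, n)} c = \<zero>\<^bsub>G\<^esub>" using c(3) w0 zero by simp
  then have cn: "c (n, n) = \<zero>\<^bsub>M n n\<^esub>"
    using restrict_entries_entry[OF n_index n_index, of "{(n, n)}" c] gmat_zero_entry[OF n_index n_index]
    by simp
  show ?thesis
  proof (rule gmat_eqI)
    fix i j assume ij: "i \<in> {1..n}" "j \<in> {1..n}"
    have "u (i, i) = \<zero>\<^bsub>M i i\<^esub>"
    proof (cases "i = n")
      case False
      then have "i \<in> {1..<n}" using ij by auto
      then show ?thesis
        using c(4) center_diagonal_eq_zero_iff[OF c(1) ij(1) n_index False] cn by simp
    qed (simp add: un)
    with ij show "u (i, j) = \<zero>\<^bsub>G\<^esub> (i, j)"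
      using supported_entry[OF u, of i j] by (cases "i = j") (auto simp: gmat_zero_entry)
  qed (auto simp: uG)
qed

text \<open>The two halves of (ii) are nested: the first reduces the vanishing of the off-diagonal
  part \<open>?o\<close> to that of each \<open>B ?o s\<close>, and the second applies to
  \<open>B ?o s\<close>, which is off-diagonal again. Afterwards \<open>u\<close> is diagonal, each
  \<open>B u s\<close> is an annihilating element of the corner and hence zero, and
  \<open>diag_annihilator_zero\<close> applies.\<close>

lemma zero_if_annihilates_off:
  assumes u: "u \<in> carrier G" and ann: "annihilates_off u"
    and ann_corner: "\<And>s. s \<in> C n n \<Longrightarrow> annihilates_off (B u s)"
    and off: "\<And>r x s. \<lbrakk>r \<in> {1..<n}; x \<in> C r r; s \<in> C n n\<rbrakk> \<Longrightarrow> B x (B u s) = \<zero>\<^bsub>G\<^esub>"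
  shows "u = \<zero>\<^bsub>G\<^esub>"
proof -
  let ?d = "restrict_entries Id u" and ?o = "restrict_entries (- Id) u"
  have d: "?d \<in> supported Id" and o: "?o \<in> supported (- Id)"
    using restrict_entries_supported[OF u] by auto
  note dG = supported_carrier[OF d] and oG = supported_carrier[OF o]
  have "?o = \<zero>\<^bsub>G\<^esub>"
  proof (rule off_right_faithful[OF o])
    fix s assume s: "s \<in> C n n"
    note sG = component_carrier[OF s]
    show "B ?o s = \<zero>\<^bsub>G\<^esub>"
    proof (rule off_left_faithful)
      show "B ?o s \<in> supported (- Id)" using B_off[OF sG o] by blast
      fix r x assume r: "r \<in> {1..<n}" and x: "x \<in> C r r"
      note xG = component_carrier[OF x]
      have "B u s = B ?d s \<oplus>\<^bsub>G\<^esub> B ?o s"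
        using B_add_left[OF dG oG sG] restrict_entries_split[OF u, of Id] by simp
      then have "B x (B u s) = B x (B ?d s) \<oplus>\<^bsub>G\<^esub> B x (B ?o s)"
        using dG oG sG xG by (simp add: B_add_right B_closed)
      \<comment> \<open>\<open>B ?d s\<close> lies in the corner component, while \<open>x\<close>
        lies in a diagonal component with \<open>r < n\<close>; hence the diagonal part of
        \<open>u\<close> is invisible here.\<close>
      moreover have "B x (B ?d s) = \<zero>\<^bsub>G\<^esub>"
        using r by (intro diag_diag_zero[OF _ n_index _ x B_diag_corner[OF d s]]) auto
      ultimately show "B x (B ?o s) = \<zero>\<^bsub>G\<^esub>"
        using off[OF r x s] xG oG sG by (simp add: B_closed)
    qed
  qed
  then have "u = ?d" using restrict_entries_split[OF u, of Id] dG by simp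
  with d have u': "u \<in> supported Id" by simp
  show ?thesis
  proof (rule diag_annihilator_zero[OF u' ann])
    fix s assume "s \<in> C n n"
    then show "B u s = \<zero>\<^bsub>G\<^esub>"
      by (intro corner_annihilator_zero B_diag_corner[OF u'] ann_corner)
  qed
qed

section \<open>Vanishing of the compatible map\<close>

proposition compatible_map_zero:
  assumes f: "f \<in> carrier G \<rightarrow> carrier G \<rightarrow> carrier G"
    and f_zero: "\<And>x. x \<in> carrier G \<Longrightarrow> f x \<zero>\<^bsub>G\<^esub> = \<zero>\<^bsub>G\<^esub> \<and> f \<zero>\<^bsub>G\<^esub> x = \<zero>\<^bsub>G\<^esub>"
    and right: "\<And>x y z. \<lbrakk>x \<in> carrier G; y \<in> carrier G; z \<in> carrier G\<rbrakk>
      \<Longrightarrow> B (f x y) z = f (B x z) (B y z)"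
    and left: "\<And>x y z. \<lbrakk>x \<in> carrier G; y \<in> carrier G; z \<in> carrier G\<rbrakk>
      \<Longrightarrow> B z (f x y) = f (B z x) (B z y)"
    and x: "x \<in> carrier G" and y: "y \<in> carrier G"
  shows "f x y = \<zero>\<^bsub>G\<^esub>"
proof -
  have f_closed: "f x y \<in> carrier G" if "x \<in> carrier G" "y \<in> carrier G" for x y
    using f that by blast
  note cl = f_closed B_closed
  have ann_zero: "annihilates_off \<zero>\<^bsub>G\<^esub>"
    by (simp add: annihilates_off_def B_zero_left B_zero_right supported_carrier)
  \<comment> \<open>Pairing with a corner element sends the first argument to zero, and pairing with
    an off-diagonal element sends the second to zero. By (vii) the value of \<open>f\<close>
    vanishes either way, which yields all premises of
    \<open>zero_if_annihilates_off\<close>.\<close>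
  have diag_off_zero: "f x y = \<zero>\<^bsub>G\<^esub>"
    if r: "r \<in> {1..<n}" and x: "x \<in> C r r" and y: "y \<in> supported (- Id)" for r x y
  proof -
    note xG = component_carrier[OF x] and yG = supported_carrier[OF y]
    have Bs: "B (f x y) s = \<zero>\<^bsub>G\<^esub>" if s: "s \<in> C n n" for s
    proof -
      have "B x s = \<zero>\<^bsub>G\<^esub>" using r by (intro diag_diag_zero[OF _ n_index _ x s]) auto
      then show ?thesis using xG yG component_carrier[OF s] by (simp add: right cl f_zero)
    qed
    have "annihilates_off (f x y)"
      unfolding annihilates_off_def
    proof (intro ballI conjI)
      fix z assume z: "z \<in> supported (- Id)"
      note zG = supported_carrier[OF z]
      show "B (f x y) z = \<zero>\<^bsub>G\<^esub>"
        using xG yG zG B_off_off[OF y z] by (simp add: right cl f_zero)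
      show "B z (f x y) = \<zero>\<^bsub>G\<^esub>"
        using xG yG zG B_off_off[OF z y] by (simp add: left cl f_zero)
    qed
    with f_closed[OF xG yG] show ?thesis
      by (rule zero_if_annihilates_off) (simp_all add: Bs ann_zero B_zero_right component_carrier)
  qed
  have ann_off: "annihilates_off (f x y)" if "x \<in> supported (- Id)" "y \<in> supported (- Id)" for x y
    unfolding annihilates_off_def using that
    by (simp add: right left supported_carrier B_off_off f_zero)
  have off_zero: "f x y = \<zero>\<^bsub>G\<^esub>"
    if x: "x \<in> supported (- Id)" and y: "y \<in> supported (- Id)" for x y
  proof (rule zero_if_annihilates_off)
    note xG = supported_carrier[OF x] and yG = supported_carrier[OF y]
    show "f x y \<in> carrier G" using xG yG by (rule f_closed)
    show "annihilates_off (f x y)" using ann_off[OF x y] .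
    fix s assume s: "s \<in> C n n"
    note sG = component_carrier[OF s]
    show "annihilates_off (B (f x y) s)"
      using xG yG sG B_off[OF sG x] B_off[OF sG y] by (simp add: right ann_off)
    fix r t assume r: "r \<in> {1..<n}" and t: "t \<in> C r r"
    note tG = component_carrier[OF t]
    have r': "r \<in> {1..n}" "r \<noteq> n" using r by auto
    let ?x = "B x s" and ?y = "B t y"
    have x': "?x \<in> supported (- Id)" and y': "?y \<in> supported (- Id)"
      using B_off[OF sG x] B_off[OF tG y] by auto
    note x'G = supported_carrier[OF x'] and y'G = supported_carrier[OF y']
    \<comment> \<open>Both arguments are values of \<open>B _ (?x \<oplus> s)\<close>, since \<open>B t s\<close> and \<open>B ?y ?x\<close> vanish.\<close>
    have "B t (B (f x y) s) = f (B t ?x) (B t (B y s))"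
      using xG yG sG tG by (simp add: right left cl)
    also have "B t (B y s) = B ?y s" by (rule pairing_assoc_off[OF r'(1) t y s])
    also have "f (B t ?x) (B ?y s) = f (B t (?x \<oplus>\<^bsub>G\<^esub> s)) (B ?y (?x \<oplus>\<^bsub>G\<^esub> s))"
      using x'G y'G sG tG diag_diag_zero[OF r'(1) n_index r'(2) t s] B_off_off[OF y' x']
      by (simp add: B_add_right B_closed)
    \<comment> \<open>(viii) read backwards extracts the common right factor and leaves
      \<open>f\<close> at a diagonal and an off-diagonal argument, the case already settled.\<close>
    also have "\<dots> = B (f t ?y) (?x \<oplus>\<^bsub>G\<^esub> s)"
      using x'G y'G sG tG by (simp add: right)
    also have "\<dots> = \<zero>\<^bsub>G\<^esub>"
      using x'G sG diag_off_zero[OF r t y'] by (simp add: B_zero_left)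
    finally show "B t (B (f x y) s) = \<zero>\<^bsub>G\<^esub>" .
  qed
  have ann: "annihilates_off (f x y)" if "x \<in> carrier G" "y \<in> carrier G" for x y
    unfolding annihilates_off_def using that
    by (simp add: right left supported_carrier B_off off_zero)
  show ?thesis
  proof (rule zero_if_annihilates_off)
    show "f x y \<in> carrier G" "annihilates_off (f x y)" using x y by (simp_all add: cl ann)
    fix s assume s: "s \<in> C n n"
    note sG = component_carrier[OF s]
    show "annihilates_off (B (f x y) s)" using x y sG by (simp add: right cl ann)
    fix r t assume r: "r \<in> {1..<n}" and t: "t \<in> C r r"
    note tG = component_carrier[OF t]
    have r': "r \<in> {1..n}" "r \<noteq> n" using r by auto
    \<comment> \<open>The diagonal part of \<open>v\<close> is sent into the corner by
      \<open>s\<close> and then killed by \<open>t\<close>, while the off-diagonal part stays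
      off-diagonal. Applied to \<open>x\<close> and \<open>y\<close>, this brings
      \<open>B t (B (f x y) s)\<close> under \<open>off_zero\<close>.\<close>
    have off: "B t (B v s) \<in> supported (- Id)" if v: "v \<in> carrier G" for v
    proof -
      let ?d = "restrict_entries Id v" and ?o = "restrict_entries (- Id) v"
      have d: "?d \<in> supported Id" and o: "?o \<in> supported (- Id)"
        using restrict_entries_supported[OF v] by auto
      have "B t (B v s) = B t (B (?d \<oplus>\<^bsub>G\<^esub> ?o) s)"
        using restrict_entries_split[OF v, of Id] by simp
      also have "\<dots> = B t (B ?d s) \<oplus>\<^bsub>G\<^esub> B t (B ?o s)"
        using d o sG tG by (simp add: B_add_left B_add_right B_closed supported_carrier)
      also have "B t (B ?d s) = \<zero>\<^bsub>G\<^esub>"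
        by (rule diag_diag_zero[OF r'(1) n_index r'(2) t B_diag_corner[OF d s]])
      finally show ?thesis
        using B_off[OF tG conjunct2[OF B_off[OF sG o]]] zero_supported by (simp add: add_supported)
    qed
    show "B t (B (f x y) s) = \<zero>\<^bsub>G\<^esub>"
      using x y sG tG by (simp add: right left cl off off_zero)
  qed
qed

end

section \<open>Passage from sums over components to supports\<close>

theorem theorem2p1:
  fixes n :: nat and M :: "'a bimod_family" and \<phi> :: "'a tensor_maps"
    and B f :: "'a gmat \<Rightarrow> 'a gmat \<Rightarrow> 'a gmat"
  defines "G \<equiv> gmat_ring n M \<phi>"
    and "C \<equiv> gmat_component n M \<phi>"
  assumes n: "n \<ge> 2"
    and gmr: "generalized_matrix_ring n M \<phi>"
    and B: "biadditive G B"
    and i_diag: "\<And>p q. \<lbrakk>p \<in> {1..n}; q \<in> {1..n}\<rbrakk>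
      \<Longrightarrow> image2 B (C p p) (C q q) \<subseteq> C p p \<inter> C q q"
    and i_mixed: "\<And>p r s. \<lbrakk>p \<in> {1..n}; r \<in> {1..n}; s \<in> {1..n}; r \<noteq> s\<rbrakk>
      \<Longrightarrow> image2 B (C p p) (C r s) \<subseteq> C r s \<and> image2 B (C r s) (C p p) \<subseteq> C r s"
    and i_off: "\<And>p q r s. \<lbrakk>p \<in> {1..n}; q \<in> {1..n}; r \<in> {1..n}; s \<in> {1..n}; p \<noteq> q; r \<noteq> s\<rbrakk>
      \<Longrightarrow> image2 B (C p q) (C r s) = {\<zero>\<^bsub>G\<^esub>}"
    and ii: "\<And>c cc.
      \<lbrakk>c \<in> (\<Pi> (p, q) \<in> {(p, q) \<in> {1..n} \<times> {1..n}. p \<noteq> q}. C p q);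
       cc = (\<Oplus>\<^bsub>G\<^esub> pq \<in> {(p, q) \<in> {1..n} \<times> {1..n}. p \<noteq> q}. c pq);
       image2 B {cc} (C n n) = {\<zero>\<^bsub>G\<^esub>} \<or>
       image2 B {\<Oplus>\<^bsub>G\<^esub> r \<in> {1..<n}. d r | d. d \<in> (\<Pi> r \<in> {1..<n}. C r r)} {cc} = {\<zero>\<^bsub>G\<^esub>}\<rbrakk>
      \<Longrightarrow> cc = \<zero>\<^bsub>G\<^esub>"
    and iii: "\<And>a. \<lbrakk>a \<in> C n n; image2 B (C n n) {a} = {\<zero>\<^bsub>G\<^esub>}\<rbrakk> \<Longrightarrow> a = \<zero>\<^bsub>G\<^esub>"
    and iv: "\<And>c. \<lbrakk>c \<in> (\<Pi> p \<in> {1..n}. C p p);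
       \<And>r s. \<lbrakk>r \<in> {1..n}; s \<in> {1..n}; r \<noteq> s\<rbrakk>
         \<Longrightarrow> image2 B {\<Oplus>\<^bsub>G\<^esub> p \<in> {1..n}. c p} (C r s) = {\<zero>\<^bsub>G\<^esub>} \<and>
             image2 B (C r s) {\<Oplus>\<^bsub>G\<^esub> p \<in> {1..n}. c p} = {\<zero>\<^bsub>G\<^esub>}\<rbrakk>
      \<Longrightarrow> (\<Oplus>\<^bsub>G\<^esub> p \<in> {1..<n}. c p) \<oplus>\<^bsub>G\<^esub> (\<ominus>\<^bsub>G\<^esub> c n) \<in> ring_center G"
    and v_comm: "\<And>c p d. \<lbrakk>c \<in> (\<Pi> p \<in> {1..n}. C p p);
       (\<Oplus>\<^bsub>G\<^esub> p \<in> {1..n}. c p) \<in> ring_center G; p \<in> {1..n}; d \<in> C p p\<rbrakk>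
      \<Longrightarrow> B (c p) d = B d (c p)"
    and v_mult: "\<And>c p dpp dpn dnn. \<lbrakk>c \<in> (\<Pi> p \<in> {1..n}. C p p);
       (\<Oplus>\<^bsub>G\<^esub> p \<in> {1..n}. c p) \<in> ring_center G; p \<in> {1..<n};
       dpp \<in> C p p; dpn \<in> C p n; dnn \<in> C n n\<rbrakk>
      \<Longrightarrow> B (c p) dpp \<otimes>\<^bsub>G\<^esub> dpn \<otimes>\<^bsub>G\<^esub> dnn = dpp \<otimes>\<^bsub>G\<^esub> dpn \<otimes>\<^bsub>G\<^esub> B (c n) dnn"
    and vi: "\<And>r k l crr ckl cnn. \<lbrakk>r \<in> {1..n}; k \<in> {1..n}; l \<in> {1..n}; k \<noteq> l;
       crr \<in> C r r; ckl \<in> C k l; cnn \<in> C n n\<rbrakk>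
      \<Longrightarrow> B crr (B ckl cnn) = B (B crr ckl) cnn"
    and f: "f \<in> carrier G \<rightarrow> carrier G \<rightarrow> carrier G"
    and vii: "\<And>x. x \<in> carrier G \<Longrightarrow> f x \<zero>\<^bsub>G\<^esub> = \<zero>\<^bsub>G\<^esub> \<and> f \<zero>\<^bsub>G\<^esub> x = \<zero>\<^bsub>G\<^esub>"
    and viii: "\<And>x y z. \<lbrakk>x \<in> carrier G; y \<in> carrier G; z \<in> carrier G\<rbrakk>
      \<Longrightarrow> B (f x y) z = f (B x z) (B y z)"
    and ix: "\<And>x y z. \<lbrakk>x \<in> carrier G; y \<in> carrier G; z \<in> carrier G\<rbrakk>
      \<Longrightarrow> B z (f x y) = f (B z x) (B z y)"
  shows "\<forall>x \<in> carrier G. \<forall>y \<in> carrier G. f x y = \<zero>\<^bsub>G\<^esub>"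
proof -
  interpret gm: generalized_matrix_ring n M \<phi> by (rule gmr)
  note [simp] = G_def C_def and [simp del] = One_nat_def
  \<comment> \<open>(ii), (iii) and (iv) require the image to be equal to the zero singleton, which
    fails when a factor is empty; hence the two non-emptiness conditions.\<close>
  have image2_zeroI: "image2 B X Y = {\<zero>\<^bsub>G\<^esub>}"
    if zero: "\<And>x y. \<lbrakk>x \<in> X; y \<in> Y\<rbrakk> \<Longrightarrow> B x y = \<zero>\<^bsub>G\<^esub>" and ne: "X \<noteq> {}" "Y \<noteq> {}" for X Y
  proof
    show "image2 B X Y \<subseteq> {\<zero>\<^bsub>G\<^esub>}" using zero unfolding image2_def by blast
    obtain x y where "x \<in> X" "y \<in> Y" using ne by blast
    then show "{\<zero>\<^bsub>G\<^esub>} \<subseteq> image2 B X Y" using zero[of x y] unfolding image2_def by force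
  qed
  have C_nonempty: "C p q \<noteq> {}" for p q
    using gm.zero_supported[of "{(p, q)}"] by (auto simp: gm.component_eq_supported)
  have B_add: "B (x \<oplus>\<^bsub>G\<^esub> y) z = B x z \<oplus>\<^bsub>G\<^esub> B y z"
    if "x \<in> carrier G" "y \<in> carrier G" "z \<in> carrier G" for x y z
    using B that by (auto simp: biadditive_def)
  have B_zero: "B \<zero>\<^bsub>G\<^esub> x = \<zero>\<^bsub>G\<^esub>" if "x \<in> carrier G" for x
  proof (rule gm.gmat.zero_if_double[folded G_def])
    show "B \<zero>\<^bsub>G\<^esub> x \<in> carrier G" using B that gm.gmat.zero_closed by (auto simp: biadditive_def)
    show "B \<zero>\<^bsub>G\<^esub> x \<oplus>\<^bsub>G\<^esub> B \<zero>\<^bsub>G\<^esub> x = B \<zero>\<^bsub>G\<^esub> x"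
      using B_add[of "\<zero>\<^bsub>G\<^esub>" "\<zero>\<^bsub>G\<^esub>" x] that gm.gmat.zero_closed by simp
  qed
  let ?off = "{(p, q) \<in> {1..n} \<times> {1..n}. p \<noteq> q}"
  \<comment> \<open>This puts an off-diagonal matrix into the form demanded by (ii), with its own
    single-entry restrictions as summands.\<close>
  have off_sum: "x = (\<Oplus>\<^bsub>G\<^esub> pq \<in> ?off. gm.restrict_entries {pq} x)"
      "(\<lambda>pq. gm.restrict_entries {pq} x) \<in> (\<Pi> (p, q) \<in> ?off. C p q)"
    if x: "x \<in> gm.supported (- Id)" for x
  proof -
    have "x \<in> gm.supported ?off" using x by (auto simp: gm.supported_def)
    then show "x = (\<Oplus>\<^bsub>G\<^esub> pq \<in> ?off. gm.restrict_entries {pq} x)"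
      unfolding G_def by (rule gm.supported_eq_finsum) auto
    show "(\<lambda>pq. gm.restrict_entries {pq} x) \<in> (\<Pi> (p, q) \<in> ?off. C p q)"
      using gm.restrict_entries_supported[OF gm.supported_carrier[OF x]]
      by (auto simp: gm.component_eq_supported)
  qed
  have diag_fun: "(\<lambda>p. gm.restrict_entries {(p, p)} u) \<in> (\<Pi> p \<in> {1..n}. C p p)"
    if "u \<in> carrier G" for u
    using gm.restrict_entries_supported that by (simp add: gm.component_eq_supported)
  have diag_sum: "(\<Oplus>\<^bsub>G\<^esub> p \<in> {1..n}. gm.restrict_entries {(p, p)} u) = u"
    if u: "u \<in> gm.supported Id" for u
  proof -
    have "gm.restrict_entries (Id_on {1..n}) u = u"
      by (rule gm.restrict_entries_id[OF u]) auto
    then show ?thesis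
      using gm.restrict_entries_diag_eq_finsum[OF gm.supported_carrier[OF u] order_refl] by simp
  qed
  interpret diagonal_pairing n M \<phi> B
  proof
    show "2 \<le> n" by (rule n)
    show "biadditive (gmat_ring n M \<phi>) B" using B by simp
    show "B x y \<in> gmat_component n M \<phi> p p \<inter> gmat_component n M \<phi> q q"
      if "p \<in> {1..n}" "q \<in> {1..n}"
        "x \<in> gmat_component n M \<phi> p p" "y \<in> gmat_component n M \<phi> q q" for p q x y
      using i_diag[OF that(1,2)] that(3,4) unfolding image2_def C_def by blast
    show "B x y \<in> gmat_component n M \<phi> r s \<and> B y x \<in> gmat_component n M \<phi> r s"
      if "p \<in> {1..n}" "r \<in> {1..n}" "s \<in> {1..n}" "r \<noteq> s"
        "x \<in> gmat_component n M \<phi> p p" "y \<in> gmat_component n M \<phi> r s" for p r s x y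
      using i_mixed[OF that(1-4)] that(5,6) unfolding image2_def C_def by blast
    show "B x y = \<zero>\<^bsub>gmat_ring n M \<phi>\<^esub>"
      if "p \<in> {1..n}" "q \<in> {1..n}" "r \<in> {1..n}" "s \<in> {1..n}" "p \<noteq> q" "r \<noteq> s"
        "x \<in> gmat_component n M \<phi> p q" "y \<in> gmat_component n M \<phi> r s" for p q r s x y
      using i_off[OF that(1-6)] that(7,8) unfolding image2_def C_def G_def by blast
    show "x = \<zero>\<^bsub>gmat_ring n M \<phi>\<^esub>"
      if x: "x \<in> gm.supported (- Id)"
        and z: "\<And>z. z \<in> gmat_component n M \<phi> n n \<Longrightarrow> B x z = \<zero>\<^bsub>gmat_ring n M \<phi>\<^esub>" for x
    proof -
      have "image2 B {x} (C n n) = {\<zero>\<^bsub>G\<^esub>}"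
        using z C_nonempty by (intro image2_zeroI) auto
      then show ?thesis using ii[OF off_sum(2,1)[OF x]] by simp
    qed
    show "x = \<zero>\<^bsub>gmat_ring n M \<phi>\<^esub>"
      if x: "x \<in> gm.supported (- Id)"
        and z: "\<And>r z. \<lbrakk>r \<in> {1..<n}; z \<in> gmat_component n M \<phi> r r\<rbrakk>
          \<Longrightarrow> B z x = \<zero>\<^bsub>gmat_ring n M \<phi>\<^esub>" for x
    proof -
      note xG = gm.supported_carrier[OF x, folded G_def]
      \<comment> \<open>(ii) tests \<open>x\<close> against all sums of diagonal components, but
        only the individual components are known to annihilate it; additivity in the first argument
        bridges the gap, one index at a time.\<close>
      have "B (\<Oplus>\<^bsub>G\<^esub> r \<in> A. d r) x = \<zero>\<^bsub>G\<^esub>"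
        if "finite A" "A \<subseteq> {1..<n}" "d \<in> (\<Pi> r \<in> {1..<n}. C r r)" for A d
        using that(1,2)
      proof (induction A)
        case empty
        then show ?case using B_zero[OF xG] by simp
      next
        case (insert r A)
        have d: "d s \<in> carrier G" if "s \<in> insert r A" for s
          using that insert.prems \<open>d \<in> _\<close> by (auto simp: gmat_component_def)
        then have "(\<Oplus>\<^bsub>G\<^esub> s \<in> insert r A. d s) = d r \<oplus>\<^bsub>G\<^esub> (\<Oplus>\<^bsub>G\<^esub> s \<in> A. d s)"
          using insert.hyps gm.gmat.finsum_insert[of A r d] by auto
        moreover have "(\<Oplus>\<^bsub>G\<^esub> s \<in> A. d s) \<in> carrier G"
          using d gm.gmat.finsum_closed[of d A] by auto
        moreover have "B (d r) x = \<zero>\<^bsub>G\<^esub>"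
          using z[of r "d r"] Pi_mem[OF \<open>d \<in> _\<close>, of r] insert.prems by auto
        ultimately show ?case
          using B_add[OF d _ xG, of r] insert gm.gmat.l_zero gm.gmat.zero_closed by auto
      qed
      \<comment> \<open>The zero family shows that the set of sums is not empty.\<close>
      moreover have "(\<lambda>r. \<zero>\<^bsub>G\<^esub>) \<in> (\<Pi> r \<in> {1..<n}. C r r)"
        using gm.zero_supported by (simp add: gm.component_eq_supported)
      ultimately have "image2 B {\<Oplus>\<^bsub>G\<^esub> r \<in> {1..<n}. d r | d. d \<in> (\<Pi> r \<in> {1..<n}. C r r)} {x} = {\<zero>\<^bsub>G\<^esub>}"
        by (intro image2_zeroI) blast+
      then show ?thesis using ii[OF off_sum(2,1)[OF x]] by simp
    qed
    show "a = \<zero>\<^bsub>gmat_ring n M \<phi>\<^esub>"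
      if a: "a \<in> gmat_component n M \<phi> n n"
        and z: "\<And>z. z \<in> gmat_component n M \<phi> n n \<Longrightarrow> B z a = \<zero>\<^bsub>gmat_ring n M \<phi>\<^esub>" for a
    proof -
      have "image2 B (C n n) {a} = {\<zero>\<^bsub>G\<^esub>}"
        using z C_nonempty by (intro image2_zeroI) auto
      then show ?thesis using iii[of a] a by simp
    qed
    show "gm.restrict_entries (Id_on {1..<n}) u
        \<oplus>\<^bsub>gmat_ring n M \<phi>\<^esub> \<ominus>\<^bsub>gmat_ring n M \<phi>\<^esub> gm.restrict_entries {(n, n)} u
        \<in> ring_center (gmat_ring n M \<phi>)"
      if u: "u \<in> gm.supported Id"
        and z: "\<And>z. z \<in> gm.supported (- Id)
          \<Longrightarrow> B u z = \<zero>\<^bsub>gmat_ring n M \<phi>\<^esub> \<and> B z u = \<zero>\<^bsub>gmat_ring n M \<phi>\<^esub>" for u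
    proof -
      note uG = gm.supported_carrier[OF u, folded G_def]
      have "image2 B {u} (C r s) = {\<zero>\<^bsub>G\<^esub>} \<and> image2 B (C r s) {u} = {\<zero>\<^bsub>G\<^esub>}"
        if "r \<noteq> s" for r s
      proof -
        have "C r s \<subseteq> gm.supported (- Id)"
          using gm.supported_mono[of "{(r, s)}" "- Id"] that by (simp add: gm.component_eq_supported)
        then show ?thesis using z C_nonempty by (intro conjI image2_zeroI) auto
      qed
      then have "(\<Oplus>\<^bsub>G\<^esub> p \<in> {1..<n}. gm.restrict_entries {(p, p)} u)
          \<oplus>\<^bsub>G\<^esub> \<ominus>\<^bsub>G\<^esub> gm.restrict_entries {(n, n)} u \<in> ring_center G"
        by (intro iv[OF diag_fun[OF uG]]) (simp only: diag_sum[OF u])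
      then show ?thesis
        using gm.restrict_entries_diag_eq_finsum[of u "{1..<n}"] uG
        by (simp add: subset_iff)
    qed
    show "B (gm.restrict_entries {(p, p)} c) d = B d (gm.restrict_entries {(p, p)} c)"
      if c: "c \<in> gm.supported Id" "c \<in> ring_center (gmat_ring n M \<phi>)"
        and p: "p \<in> {1..n}" and d: "d \<in> gmat_component n M \<phi> p p" for c p d
      using v_comm[OF diag_fun[of c] _ p, of d] diag_sum[OF c(1)] c(2) d
        gm.supported_carrier[OF c(1)] by simp
    show "B x (B y z) = B (B x y) z"
      if "r \<in> {1..n}" "k \<in> {1..n}" "l \<in> {1..n}" "k \<noteq> l"
        "x \<in> gmat_component n M \<phi> r r" "y \<in> gmat_component n M \<phi> k l"
        "z \<in> gmat_component n M \<phi> n n" for r k l x y z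
      using that by (intro vi[unfolded C_def])
  qed
  show ?thesis
    using compatible_map_zero[of f, folded G_def, OF f vii viii ix] by blast
qed

end
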